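(* Fix $\Delta t\in(0,1)$ and let $\mu,\sigma,p_1,\dots,p_d$ satisfy the standing assumptions (A1)-(A4) and the long-time assumptions (L1)-(L4) of the context. Then the Markov chain generated by the skew-symmetric scheme with step size $\Delta t$ has an invariant probability measure $\pi_{\Delta t}$ with finite moments of all orders. Furthermore, denoting by $P$ the Markov kernel of the chain, there exist $C>0$, $\lambda>0$ and $V:\mathbb{R}^d\to[1,\infty)$ such that for all $n\in\mathbb{N}$ and $x\in\mathbb{R}^d$ $$\|P^n(x,\cdot)-\pi_{\Delta t}\|_{TV}\le C\,V(x)\,e^{-\lambda n},$$ where $\|\cdot\|_{TV}$ is the total variation norm.
   Context: Notation: $\|\cdot\|$ Euclidean norm, $\|\cdot\|_\infty$ supremum norm on $\mathbb{R}^d$, $\|\cdot\|_F$ Frobenius norm, $\ast$ element-wise product of vectors. $C^{l,m}_P(\mathbb{R}^d)$: functions $f\in C^l(\mathbb{R}^d)$ such that for some $C>0$ every partial derivative of order $k\le l$ (including $k=0$) is bounded by $C(1+\|x\|^m)$; $C^l_P=\bigcup_mC^{l,m}_P$, $C^\infty_P=\bigcap_lC^l_P$. Data: $\mu:\mathbb{R}^d\to\mathbb{R}^d$, $\sigma:\mathbb{R}^d\to\mathbb{R}^{d\times d}$, $p_i:\mathbb{R}^d\times\mathbb{R}^d\to(0,1)$, and $q_i(x,\xi):=p_i(x,\Delta t^{-1/2}\xi)$. Standing assumptions. (A1) $\mu_i\in C^\infty_P$ and for some $C>0$, $(\mu(y)-\mu(x))\cdot(y-x)\le C^2(1+\|y-x\|^2)$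 for all $x,y$. (A2) $\sigma_{i,j}\in C^\infty_P$; for some $C>0$, $\|\sigma(y)-\sigma(x)\|_F^2\le C^2\|y-x\|^2$ for all $x,y$; $\sigma(x)$ invertible for all $x$. (A3) $p_i\in C^4(\mathbb{R}^d\times\mathbb{R}^d)$, $0<p_i<1$, $p_i(x,0)=\tfrac12$ and $\partial_{\nu_i}p_i(x,0)=\tfrac12\Psi_i(x)\Delta t^{1/2}$ for all $x$, where $\Psi=\sigma^{-1}\mu$. (A4) There are $C>0$, $m\in\mathbb{N}$ such that every partial derivative of $q_i$ of order $k\le4$ in the coordinates of $(x,\xi)$ is bounded in absolute value by $C(1+\|x\|^m+\|\xi\|^m)$. Long-time assumptions. (L1) $\sigma_{i,j}(x)=0$ for all $i\ne j$, $x\in\mathbb{R}^d$. (L2) There are $M>N>0$ with $N\le\sigma_{i,i}(x)\le M$ for all $i$, $x$. (L3) For each $i$, $\mu_i(x)\to+\infty$ as $\|x\|\to\infty$ subject to $x_i<-\|x\|_\infty/2$, and $\mu_i(x)\to-\infty$ as $\|x\|\to\infty$ subject to $x_i>\|x\|_\infty/2$. (L4) For each $i$, $p_i(x,\nu)=g_i(x,\nu_i)$ for some function $g_i$ (dependence on $\nu$ only via $\nu_i$); $g_i$ is bounded away from zero on compact sets; and $g_i(x,\nu_i)\to1$ as $\nu_i\mu_i(x)\to+\infty$, $g_i(x,\nu_i)\to0$ as $\nu_i\mu_i(x)\to-\infty$ (i.e. for every $\varepsilon>0$ there is $A$ such that $g_i(x,\nu_i)>1-\varepsilon$ whenever $\nu_i\mu_i(x)>A$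 and $g_i(x,\nu_i)<\varepsilon$ whenever $\nu_i\mu_i(x)<-A$). Skew-symmetric scheme with step size $\Delta t$: given $X^n$, draw $\nu^n\sim N(0,I_d)$ independent of the past; given $X^n,\nu^n$, draw independently for $i=1,\dots,d$ the sign $b_i^n=+1$ with probability $p_i(X^n,\nu^n)$, $b_i^n=-1$ otherwise; set $X^{n+1}=X^n+\Delta t^{1/2}\sigma(X^n)(b^n\ast\nu^n)$. *)

theory Defs
  imports "HOL-Probability.Probability"
begin

definition partial_deriv :: "'a::euclidean_space \<Rightarrow> ('a \<Rightarrow> real) \<Rightarrow> 'a \<Rightarrow> real" where
  "partial_deriv b f = (\<lambda>x. deriv (\<lambda>t. f (x + t *\<^sub>R b)) 0)"

primrec C_k :: "nat \<Rightarrow> ('a::euclidean_space \<Rightarrow> real) \<Rightarrow> bool" where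
  "C_k 0 f \<longleftrightarrow> continuous_on UNIV f"
| "C_k (Suc l) f \<longleftrightarrow> continuous_on UNIV f \<and>
     (\<forall>b\<in>Basis. (\<forall>x. (\<lambda>t. f (x + t *\<^sub>R b)) field_differentiable at 0) \<and> C_k l (partial_deriv b f))"

text \<open>A list \<open>[b\<^sub>1, \<dots>, b\<^sub>k]\<close> of basis vectors encodes the partial derivative
  \<open>\<partial>\<^bsub>b\<^sub>1\<^esub> \<dots> \<partial>\<^bsub>b\<^sub>k\<^esub> f\<close> of order \<open>k\<close>.\<close>

definition iter_partial :: "'a::euclidean_space list \<Rightarrow> ('a \<Rightarrow> real) \<Rightarrow> 'a \<Rightarrow> real" where
  "iter_partial bs f = foldr partial_deriv bs f"

definition partials_bounded_by :: "nat \<Rightarrow> ('a::euclidean_space \<Rightarrow> real) \<Rightarrow> ('a \<Rightarrow> real) \<Rightarrow> bool" where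
  "partials_bounded_by l f h \<longleftrightarrow>
     (\<forall>bs. set bs \<subseteq> Basis \<and> length bs \<le> l \<longrightarrow> (\<forall>x. \<bar>iter_partial bs f x\<bar> \<le> h x))"

definition C_poly :: "nat \<Rightarrow> nat \<Rightarrow> ('a::euclidean_space \<Rightarrow> real) \<Rightarrow> bool" where
  "C_poly l m f \<longleftrightarrow> C_k l f \<and> (\<exists>C>0. partials_bounded_by l f (\<lambda>x. C * (1 + norm x ^ m)))"

definition C_poly_infty :: "('a::euclidean_space \<Rightarrow> real) \<Rightarrow> bool" where
  "C_poly_infty f \<longleftrightarrow> (\<forall>l. \<exists>m. C_poly l m f)"

definition std_gaussian :: "(real ^ 'd) measure" where
  "std_gaussian = density lborel (\<lambda>v. ennreal (\<Prod>i\<in>UNIV. std_normal_density (v $ i)))"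

definition sign_pmf :: "real \<Rightarrow> real pmf" where
  "sign_pmf r = map_pmf (\<lambda>b. if b then 1 else - 1) (bernoulli_pmf r)"

text \<open>The product of two vectors in \<^typ>\<open>real ^ 'd\<close> is the element-wise one. The default value
  \<open>0\<close> of \<^const>\<open>Pi_pmf\<close> plays no role since the index set is \<^const>\<open>UNIV\<close>. The drift enters
  the scheme only through \<open>p\<close>.\<close>

definition skew_kernel ::
    "real \<Rightarrow> (real ^ 'd \<Rightarrow> real ^ 'd ^ 'd) \<Rightarrow> ('d \<Rightarrow> (real ^ 'd) \<times> (real ^ 'd) \<Rightarrow> real)
      \<Rightarrow> real ^ 'd \<Rightarrow> (real ^ 'd) measure" where
  "skew_kernel dt \<sigma> p x =
     std_gaussian \<bind> (\<lambda>v.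
       distr (measure_pmf (Pi_pmf UNIV 0 (\<lambda>i. sign_pmf (p i (x, v))))) borel
         (\<lambda>b. x + sqrt dt *\<^sub>R (\<sigma> x *v ((\<chi> i. b i) * v))))"

primrec kernel_power :: "('a::topological_space \<Rightarrow> 'a measure) \<Rightarrow> nat \<Rightarrow> 'a \<Rightarrow> 'a measure" where
  "kernel_power P 0 x = return borel x"
| "kernel_power P (Suc n) x = kernel_power P n x \<bind> P"

definition invariant_prob :: "('a::topological_space \<Rightarrow> 'a measure) \<Rightarrow> 'a measure \<Rightarrow> bool" where
  "invariant_prob P M \<longleftrightarrow> prob_space M \<and> sets M = sets borel \<and> M \<bind> P = M"

text \<open>Total variation norm of \<open>M - N\<close>, normalised as the total mass of \<open>\<bar>M - N\<bar>\<close> (so it is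
  at most \<open>2\<close>, rather than \<open>1\<close>, for probability measures). It is meant for finite measures on
  the same \<open>\<sigma>\<close>-algebra, where the supremum is over a bounded set.\<close>

definition tv_norm_diff :: "'a measure \<Rightarrow> 'a measure \<Rightarrow> real" where
  "tv_norm_diff M N =
     (SUP f \<in> {f \<in> borel_measurable M. \<forall>x. \<bar>f x\<bar> \<le> 1}. \<bar>(\<integral>x. f x \<partial>M) - (\<integral>x. f x \<partial>N)\<bar>)"

end

theory Submission
  imports Defs
begin

text \<open>The chain is shown to satisfy the hypotheses of Harris' theorem, with the Lyapunov function
  \<open>V x = (\<Sum>i. exp \<bar>x\<^sub>i\<bar>)\<close>. Since \<open>\<sigma>\<close> is diagonal and each sign depends on its own noise
  coordinate only, a coordinate with \<open>\<bar>x\<^sub>i\<bar> > \<parallel>x\<parallel>\<^sub>\<infinity> / 2\<close> moves, far from the origin, towards \<open>0\<close> with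
  overwhelming probability, so that \<open>exp \<bar>x\<^sub>i\<bar>\<close> is multiplied on average by at most about
  \<open>E exp (- sqrt dt N \<bar>Z\<bar>) < 1\<close> with \<open>Z\<close> standard normal; the other coordinates only contribute
  \<open>O(exp (\<parallel>x\<parallel>\<^sub>\<infinity> / 2))\<close>. On sublevel sets of \<open>V\<close> the noise with all signs \<open>+1\<close> has a density bounded below.
  Harris' theorem itself follows Hairer and Mattingly: the kernel contracts functions in the Lipschitz
  seminorm of the distance \<open>2 + \<beta> V x + \<beta> V y\<close>, hence the \<open>n\<close>-step kernels converge uniformly on sets.\<close>

subsection \<open>Setwise limits of probability measures\<close>

text \<open>Two obstacles shape the drift estimate: the sign of a coordinate is uncontrolled while
  its noise is near \<open>0\<close>, and an inward move may overshoot the origin. The first is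
  confined to noise of size at most \<delta>, and \<delta> and the sign error \<epsilon> are fixed
  before the radius beyond which the drift dominates. Overshooting costs only an additive term, an
  exponential of the noise alone. The lower bound \<open>N\<close> on the diffusion makes inward
  moves long enough to contract; the upper bound \<open>M\<close> keeps the cost of wrong signs
  finite uniformly in the state. An exponential Lyapunov function is chosen because its
  integrability gives moments of every order in one application of Harris' theorem. The invariant
  measure does not come from completeness of a space of measures: error bounds uniform over all
  measurable sets make the setwise limit countably additive directly.\<close>

lemma prob_space_of_setwise_limit:
  fixes Q :: "nat \<Rightarrow> 'a measure"
  assumes prob: "\<And>n. prob_space (Q n)" and sets_Q: "\<And>n. sets (Q n) = sets M"
    and e: "e \<longlonglongrightarrow> 0"
    and lim: "\<And>n A. A \<in> sets M \<Longrightarrow> \<bar>measure (Q n) A - L A\<bar> \<le> e n"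
  obtains \<pi> where "prob_space \<pi>" "sets \<pi> = sets M" "\<And>A. A \<in> sets M \<Longrightarrow> measure \<pi> A = L A"
proof -
  have tends: "(\<lambda>n. measure (Q n) A) \<longlonglongrightarrow> L A" if "A \<in> sets M" for A
  proof (rule LIM_zero_cancel, rule tendsto_rabs_zero_cancel)
    show "(\<lambda>n. \<bar>measure (Q n) A - L A\<bar>) \<longlonglongrightarrow> 0"
      by (rule tendsto_sandwich[OF _ _ tendsto_const e]) (use lim[OF that] in auto)
  qed
  have nonneg: "0 \<le> L A" if "A \<in> sets M" for A
    by (rule LIMSEQ_le_const[OF tends[OF that]]) auto
  have L_space: "L (space M) = 1"
  proof (rule LIMSEQ_unique[OF tends])
    have "measure (Q n) (space M) = 1" for n
      using prob_space.prob_space[OF prob, of n] sets_eq_imp_space_eq[OF sets_Q, of n] by simp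
    then show "(\<lambda>n. measure (Q n) (space M)) \<longlonglongrightarrow> 1" by simp
  qed auto
  have L_empty: "L {} = 0"
    using tends[of "{}"] by (simp add: LIMSEQ_const_iff)
  have L_add: "L (A \<union> B) = L A + L B" if "A \<in> sets M" "B \<in> sets M" "A \<inter> B = {}" for A B
  proof (rule LIMSEQ_unique[OF tends])
    have "measure (Q n) (A \<union> B) = measure (Q n) A + measure (Q n) B" for n
    proof -
      interpret prob_space "Q n" by (rule prob)
      show ?thesis using that sets_Q[of n] by (intro finite_measure_Union) auto
    qed
    then show "(\<lambda>n. measure (Q n) (A \<union> B)) \<longlonglongrightarrow> L A + L B"
      using tendsto_add[OF tends[OF that(1)] tends[OF that(2)]] by simp
  qed (use that in auto)
  have "countably_additive (sets M) (\<lambda>A. ennreal (L A))"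
  proof (rule sets.empty_continuous_imp_countably_additive)
    show "positive (sets M) (\<lambda>A. ennreal (L A))" by (simp add: positive_def L_empty)
    show "additive (sets M) (\<lambda>A. ennreal (L A))"
      unfolding additive_def by (auto simp: L_add nonneg ennreal_plus)
    fix A :: "nat \<Rightarrow> 'a set"
    assume A: "range A \<subseteq> sets M" "decseq A" "(\<Inter>i. A i) = {}"
    then have AM: "A i \<in> sets M" for i by auto
    \<comment> \<open>First \<open>n\<close> is fixed with error below \<open>r / 2\<close> on all
      sets at once, and only then continuity from above of the single measure \<open>Q n\<close> is
      used. The common rate \<open>e\<close> is what permits this order.\<close>
    have "(\<lambda>i. L (A i)) \<longlonglongrightarrow> 0"
    proof (rule LIMSEQ_I)
      fix r :: real assume "0 < r"
      obtain n where n: "e n < r / 2"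
        using order_tendstoD(2)[OF e, of "r / 2"] \<open>0 < r\<close> by (auto simp: eventually_sequentially)
      interpret prob_space "Q n" by (rule prob)
      have "(\<lambda>i. measure (Q n) (A i)) \<longlonglongrightarrow> measure (Q n) (\<Inter>i. A i)"
        by (rule finite_Lim_measure_decseq) (use A sets_Q in auto)
      then have "(\<lambda>i. measure (Q n) (A i)) \<longlonglongrightarrow> 0" using A(3) by simp
      from order_tendstoD(2)[OF this, of "r / 2"] \<open>0 < r\<close>
      obtain i0 where "\<And>i. i \<ge> i0 \<Longrightarrow> measure (Q n) (A i) < r / 2"
        unfolding eventually_sequentially by auto
      then have "norm (L (A i) - 0) < r" if "i \<ge> i0" for i
        using lim[OF AM, of n i] n nonneg[OF AM, of i] that by (fastforce simp: abs_le_iff)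
      then show "\<exists>no. \<forall>i\<ge>no. norm (L (A i) - 0) < r" by blast
    qed
    then show "(\<lambda>i. ennreal (L (A i))) \<longlonglongrightarrow> 0"
      using tendsto_ennrealI by fastforce
  qed auto
  then have em: "emeasure (measure_of (space M) (sets M) (\<lambda>A. ennreal (L A))) A = ennreal (L A)"
    if "A \<in> sets M" for A
    using that by (intro emeasure_measure_of_sigma sets.sigma_algebra_axioms)
      (auto simp: positive_def L_empty)
  show ?thesis
  proof (rule that)
    show "prob_space (measure_of (space M) (sets M) (\<lambda>A. ennreal (L A)))"
      by (rule prob_spaceI) (simp add: em L_space)
  qed (simp_all add: measure_def em nonneg)
qed

text \<open>The functions \<open>\<lfloor>m f\<rfloor> / m\<close> are averages of indicators of the level sets of \<open>f\<close> and
  approximate it within \<open>1 / m\<close>, so a bound on sets carries over to \<open>[0, 1]\<close>-valued functions.\<close>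

lemma integral_diff_le_of_setwise:
  fixes f :: "'a \<Rightarrow> real"
  assumes "prob_space M" "prob_space N" and sets_eq: "sets N = sets M"
    and le: "\<And>A. A \<in> sets M \<Longrightarrow> \<bar>measure M A - measure N A\<bar> \<le> e"
    and f[measurable]: "f \<in> borel_measurable M" and f01: "\<And>x. 0 \<le> f x" "\<And>x. f x \<le> 1"
  shows "\<bar>(\<integral>x. f x \<partial>M) - (\<integral>x. f x \<partial>N)\<bar> \<le> e"
proof -
  interpret M: prob_space M by fact
  interpret N: prob_space N by fact
  define g where "g m x = (\<Sum>k\<in>{1..m}. indicator {x\<in>space M. real k \<le> real m * f x} x) / real m"
    for m :: nat and x
  have sets[measurable]: "{x\<in>space M. real k \<le> real m * f x} \<in> sets M" for k m by measurable
  have g_eq: "g m x = real (nat \<lfloor>real m * f x\<rfloor>) / real m" if "x \<in> space M" for m x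
  proof -
    have "(\<Sum>k\<in>{1..m}. indicator {x\<in>space M. real k \<le> real m * f x} x)
        = (\<Sum>k\<in>{1..m}. if real k \<le> real m * f x then 1 else 0 :: real)"
      using that by (intro sum.cong) auto
    also have "\<dots> = real (card {k\<in>{1..m}. real k \<le> real m * f x})"
      by (simp add: sum.If_cases Int_def)
    also have "{k\<in>{1..m}. real k \<le> real m * f x} = {1..nat \<lfloor>real m * f x\<rfloor>}"
    proof -
      have "real m * f x \<le> real m" using f01[of x] by (simp add: mult_left_le)
      then have *: "nat \<lfloor>real m * f x\<rfloor> \<le> m" by linarith
      have **: "real k \<le> real m * f x \<longleftrightarrow> k \<le> nat \<lfloor>real m * f x\<rfloor>" for k
        using le_nat_floor[of k "real m * f x"] of_nat_floor[of "real m * f x"] f01(1)[of x]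
        by (meson mult_nonneg_nonneg of_nat_0_le_iff of_nat_mono order.trans)
      show ?thesis unfolding ** using * by (auto simp del: le_nat_iff)
    qed
    finally show ?thesis by (simp add: g_def)
  qed
  have g_le: "\<bar>f x - g m x\<bar> \<le> 1 / real m" if "x \<in> space M" "m > 0" for x m
  proof -
    have "\<bar>real m * f x - real (nat \<lfloor>real m * f x\<rfloor>)\<bar> \<le> 1"
      using f01(1)[of x] by (simp add: of_nat_nat) linarith
    moreover have "f x - g m x = (real m * f x - real (nat \<lfloor>real m * f x\<rfloor>)) / real m"
      using that by (simp add: g_eq field_simps)
    ultimately show ?thesis using that by (simp add: divide_right_mono)
  qed
  have approx: "\<bar>(\<integral>x. f x \<partial>P) - (\<Sum>k\<in>{1..m}. measure P {x\<in>space M. real k \<le> real m * f x}) / real m\<bar>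
      \<le> 1 / real m" if P: "prob_space P" "sets P = sets M" and m: "m > 0" for P m
  proof -
    interpret prob_space P by fact
    have sp: "space P = space M" using P(2) by (rule sets_eq_imp_space_eq)
    have [measurable]: "f \<in> borel_measurable P" using f measurable_cong_sets[OF P(2) refl] by blast
    have [measurable]: "{x\<in>space M. real k \<le> real m * f x} \<in> sets P" for k using sets P by simp
    have [simp]: "integrable P f"
      by (rule integrable_const_bound[where B=1]) (use f01 in auto)
    have gi: "has_bochner_integral P (g m)
        ((\<Sum>k\<in>{1..m}. measure P {x\<in>space M. real k \<le> real m * f x}) / real m)"
      unfolding g_def
      by (intro has_bochner_integral_divide_zero has_bochner_integral_sum has_bochner_integral_real_indicator)
        (auto simp: less_top[symmetric])
    have gint[simp]: "integrable P (g m)" using gi by (rule integrable.intros)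
    have "\<bar>(\<integral>x. f x \<partial>P) - (\<integral>x. g m x \<partial>P)\<bar> = \<bar>\<integral>x. f x - g m x \<partial>P\<bar>" by simp
    also have "\<dots> \<le> (\<integral>x. \<bar>f x - g m x\<bar> \<partial>P)" by (rule integral_abs_bound)
    also have "\<dots> \<le> 1 / real m"
      by (rule integral_le_const) (use g_le m sp in auto)
    finally show ?thesis using has_bochner_integral_integral_eq[OF gi] by simp
  qed
  have *: "\<bar>(\<integral>x. f x \<partial>M) - (\<integral>x. f x \<partial>N)\<bar> \<le> e + 2 / real m" if m: "m > 0" for m
  proof -
    let ?S = "\<lambda>P. (\<Sum>k\<in>{1..m}. measure P {x\<in>space M. real k \<le> real m * f x})"
    have "\<bar>?S M - ?S N\<bar> \<le> (\<Sum>k\<in>{1..m}. e)"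
      unfolding sum_subtractf[symmetric] by (intro order.trans[OF sum_abs] sum_mono le sets)
    then have "\<bar>?S M - ?S N\<bar> \<le> real m * e" by simp
    then have "\<bar>?S M / real m - ?S N / real m\<bar> \<le> e"
      using m by (simp add: diff_divide_distrib[symmetric] field_simps)
    then show ?thesis
      using approx[OF assms(1) refl m] approx[OF assms(2) sets_eq m] by linarith
  qed
  show ?thesis
  proof (rule LIMSEQ_le_const)
    show "(\<lambda>m. e + 2 / real m) \<longlonglongrightarrow> e" by (intro tendsto_eq_intros lim_const_over_n | simp)+
    show "\<exists>M0. \<forall>m\<ge>M0. \<bar>(\<integral>x. f x \<partial>M) - (\<integral>x. f x \<partial>N)\<bar> \<le> e + 2 / real m"
      using * by (intro exI[of _ 1]) auto
  qed
qed

subsection \<open>Harris' theorem\<close>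

text \<open>The condition on \<open>R\<close> is \<open>R > 2 * K / (1 - \<gamma>)\<close>. It makes
  \<open>\<gamma> * S + 2 * K < S\<close> for \<open>S = V x + V y >= R\<close>, so a pair of
  starting points outside the sublevel set loses Lyapunov mass on average.\<close>

locale harris_kernel =
  fixes P :: "'a::topological_space \<Rightarrow> 'a measure" and V :: "'a \<Rightarrow> real" and \<gamma> K R a :: real
    and \<nu> :: "'a measure"
  assumes kernel: "P \<in> borel \<rightarrow>\<^sub>M prob_algebra borel"
    and V_meas[measurable]: "V \<in> borel_measurable borel" and V_nonneg: "0 \<le> V x"
    and \<gamma>: "0 \<le> \<gamma>" "\<gamma> < 1" and K: "0 \<le> K"
    and drift: "(\<integral>\<^sup>+y. V y \<partial>P x) \<le> ennreal (\<gamma> * V x + K)"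
    and R: "2 * K < (1 - \<gamma>) * R"
    and a: "0 < a" "a \<le> 1"
    and \<nu>: "prob_space \<nu>" "sets \<nu> = sets borel"
    and minorization: "V x \<le> R \<Longrightarrow> A \<in> sets borel \<Longrightarrow> a * measure \<nu> A \<le> measure (P x) A"
begin

lemma R_pos: "0 < R"
proof -
  have "0 < (1 - \<gamma>) * R" using K R by linarith
  then show ?thesis using \<gamma> by (simp add: zero_less_mult_iff)
qed

section \<open>The kernel and its iterates as operators on bounded functions\<close>

lemma prob_P: "prob_space (P x)" and sets_P[measurable_cong, simp]: "sets (P x) = sets borel"
  using measurable_space[OF kernel, of x] by (auto simp: space_prob_algebra)

lemma space_P[simp]: "space (P x) = UNIV"
  using sets_eq_imp_space_eq[OF sets_P] by simp

lemma kernel_subprob[measurable]: "P \<in> borel \<rightarrow>\<^sub>M subprob_algebra borel"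
  by (rule measurable_prob_algebraD[OF kernel])

lemma kernel_power_measurable: "kernel_power P n \<in> borel \<rightarrow>\<^sub>M prob_algebra borel"
proof (induction n)
  case 0
  have "kernel_power P 0 = return borel" by (simp add: fun_eq_iff)
  then show ?case using measurable_return_prob_space by metis
next
  case (Suc n)
  have "kernel_power P (Suc n) = (\<lambda>x. kernel_power P n x \<bind> P)" by (simp add: fun_eq_iff)
  then show ?case using measurable_bind_prob_space[OF Suc kernel] by metis
qed

lemma prob_kernel_power: "prob_space (kernel_power P n x)"
  and sets_kernel_power[measurable_cong, simp]: "sets (kernel_power P n x) = sets borel"
  using measurable_space[OF kernel_power_measurable, of x n] by (auto simp: space_prob_algebra)

lemma space_kernel_power[simp]: "space (kernel_power P n x) = UNIV"
  using sets_eq_imp_space_eq[OF sets_kernel_power] by simp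

definition T :: "('a \<Rightarrow> real) \<Rightarrow> 'a \<Rightarrow> real" where
  "T f = (\<lambda>y. \<integral>z. f z \<partial>P y)"

lemma T_measurable[measurable]: "f \<in> borel_measurable borel \<Longrightarrow> T f \<in> borel_measurable borel"
  unfolding T_def
  by (rule measurable_compose[OF kernel_subprob integral_measurable_subprob_algebra])

lemma integrable_bounded:
  fixes f :: "'a \<Rightarrow> real"
  assumes "prob_space M" "sets M = sets borel" "f \<in> borel_measurable borel" "\<And>x. \<bar>f x\<bar> \<le> B"
  shows "integrable M f"
proof -
  interpret prob_space M by fact
  have "f \<in> borel_measurable M" using assms(2,3) measurable_cong_sets by blast
  then show ?thesis by (intro integrable_const_bound[where B=B]) (use assms(4) in auto)
qed

lemma abs_integral_le:
  fixes f :: "'a \<Rightarrow> real"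
  assumes "prob_space M" "sets M = sets borel" "f \<in> borel_measurable borel" "\<And>x. \<bar>f x\<bar> \<le> B"
  shows "\<bar>\<integral>x. f x \<partial>M\<bar> \<le> B"
proof -
  interpret prob_space M by fact
  have "\<bar>\<integral>x. f x \<partial>M\<bar> \<le> (\<integral>x. \<bar>f x\<bar> \<partial>M)" by (rule integral_abs_bound)
  also have "\<dots> \<le> B"
    by (rule integral_le_const) (use integrable_bounded[OF assms] assms(4) in auto)
  finally show ?thesis .
qed

lemma T_bounded: "f \<in> borel_measurable borel \<Longrightarrow> (\<And>x. \<bar>f x\<bar> \<le> B) \<Longrightarrow> \<bar>T f x\<bar> \<le> B"
  unfolding T_def by (rule abs_integral_le) (auto simp: prob_P)

lemma T_funpow:
  assumes "f \<in> borel_measurable borel" "\<And>x. \<bar>f x\<bar> \<le> B"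
  shows "(T ^^ n) f \<in> borel_measurable borel" "\<bar>(T ^^ n) f x\<bar> \<le> B"
proof -
  have "(T ^^ n) f \<in> borel_measurable borel \<and> (\<forall>x. \<bar>(T ^^ n) f x\<bar> \<le> B)"
    by (induction n) (use assms T_bounded in auto)
  then show "(T ^^ n) f \<in> borel_measurable borel" "\<bar>(T ^^ n) f x\<bar> \<le> B" by auto
qed

lemma integral_bind_P:
  assumes "prob_space M" "sets M = sets borel" "f \<in> borel_measurable borel" "\<And>x. \<bar>f x\<bar> \<le> B"
  shows "(\<integral>x. f x \<partial>(M \<bind> P)) = (\<integral>x. T f x \<partial>M)"
  unfolding T_def
proof (rule integral_bind[where B=B and B'=1])
  show "P \<in> M \<rightarrow>\<^sub>M subprob_algebra borel" using kernel_subprob measurable_cong_sets[OF assms(2) refl] by blast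
  show "finite_measure M" using assms(1) by (rule prob_space.finite_measure)
  show "AE x in M. emeasure (P x) (space (P x)) \<le> ennreal 1"
    using prob_space.emeasure_space_1[OF prob_P] by simp
qed (use assms in auto)

text \<open>\<open>kernel_power\<close> appends its new step at the end. Integrating out that last
  step replaces \<open>f\<close> by \<open>T f\<close>, which is why the induction runs over
  arbitrary \<open>f\<close>.\<close>

lemma integral_kernel_power:
  assumes "f \<in> borel_measurable borel" "\<And>x. \<bar>f x\<bar> \<le> B"
  shows "(\<integral>y. f y \<partial>kernel_power P n x) = (T ^^ n) f x"
  using assms
proof (induction n arbitrary: f)
  case 0
  then show ?case by (simp add: integral_return)
next
  case (Suc n)
  have "(\<integral>y. f y \<partial>kernel_power P (Suc n) x) = (\<integral>y. T f y \<partial>kernel_power P n x)"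
    using integral_bind_P[OF prob_kernel_power sets_kernel_power Suc.prems] by simp
  also have "\<dots> = (T ^^ n) (T f) x"
    by (rule Suc.IH) (use Suc.prems T_bounded in auto)
  also have "\<dots> = (T ^^ Suc n) f x" by (simp add: funpow_swap1)
  finally show ?case .
qed

lemma V_int: "integrable (P x) V" and V_int_le: "(\<integral>y. V y \<partial>P x) \<le> \<gamma> * V x + K"
proof -
  show *: "integrable (P x) V"
    by (rule integrableI_nonneg)
      (use drift[of x] V_nonneg in \<open>auto simp: order_le_less_trans[OF _ ennreal_less_top]\<close>)
  have "ennreal (\<integral>y. V y \<partial>P x) \<le> ennreal (\<gamma> * V x + K)"
    using drift[of x] nn_integral_eq_integral[OF * AE_I2[OF V_nonneg]] by simp
  then show "(\<integral>y. V y \<partial>P x) \<le> \<gamma> * V x + K"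
    using \<gamma> K V_nonneg[of x] by (simp add: ennreal_le_iff del: ennreal_plus)
qed

text \<open>The minorization on sets is domination of measures, \<open>a\<close> times \<nu> below
  \<open>P x\<close>, and hence passes to nonnegative functions. Since \<open>a > 0\<close>,
  integrability under \<nu> comes for free, which is needed because the weight built from
  \<open>V\<close> may be unbounded.\<close>

lemma minorization_integral:
  assumes "V x \<le> R" and int: "integrable (P x) f" and nonneg: "\<And>y. 0 \<le> f y"
    and f[measurable]: "f \<in> borel_measurable borel"
  shows "integrable \<nu> f" "a * (\<integral>y. f y \<partial>\<nu>) \<le> (\<integral>y. f y \<partial>P x)"
proof -
  interpret Px: prob_space "P x" by (rule prob_P)
  interpret nu: prob_space \<nu> by (rule \<nu>)
  have f\<nu>[measurable]: "f \<in> borel_measurable \<nu>" using f measurable_cong_sets[OF \<nu>(2) refl] by blast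
  have "ennreal a * (\<integral>\<^sup>+y. f y \<partial>\<nu>) = (\<integral>\<^sup>+y. f y \<partial>scale_measure (ennreal a) \<nu>)"
    by (rule nn_integral_scale_measure[symmetric]) measurable
  also have "\<dots> \<le> (\<integral>\<^sup>+y. f y \<partial>P x)"
  proof (rule nn_integral_mono_measure)
    show "scale_measure (ennreal a) \<nu> \<le> P x"
    proof (subst le_measure)
      show "\<forall>A\<in>sets (scale_measure (ennreal a) \<nu>). emeasure (scale_measure (ennreal a) \<nu>) A \<le> emeasure (P x) A"
        using minorization[OF assms(1)] \<nu>(2) a
        by (auto simp: Px.emeasure_eq_measure nu.emeasure_eq_measure ennreal_mult[symmetric])
    qed (simp add: \<nu>)
  qed (simp add: \<nu>)
  also have "\<dots> = ennreal (\<integral>y. f y \<partial>P x)"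
    by (rule nn_integral_eq_integral[OF int]) (simp add: nonneg)
  finally have le: "ennreal a * (\<integral>\<^sup>+y. f y \<partial>\<nu>) \<le> ennreal (\<integral>y. f y \<partial>P x)" .
  have fin: "(\<integral>\<^sup>+y. f y \<partial>\<nu>) < \<infinity>"
  proof (rule ccontr)
    assume "\<not> ?thesis"
    then have "(\<integral>\<^sup>+y. f y \<partial>\<nu>) = \<infinity>" by (simp add: less_top[symmetric])
    with le a show False by (simp add: ennreal_mult_top top_unique)
  qed
  show int\<nu>: "integrable \<nu> f"
    by (rule integrableI_nonneg) (use fin nonneg in auto)
  show "a * (\<integral>y. f y \<partial>\<nu>) \<le> (\<integral>y. f y \<partial>P x)"
    using le a nonneg by (simp add: nn_integral_eq_integral[OF int\<nu>] ennreal_mult[symmetric] integral_nonneg)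
qed

text \<open>The weight \<open>\<beta>\<close> is small enough for the mass \<open>2 a\<close> gained from the minorization to outweigh
  the constant \<open>2 \<beta> K\<close> coming from the drift. If \<open>V x\<close> or \<open>V y\<close> exceeds \<open>R\<close>, the drift alone contracts.\<close>

definition \<beta> :: real where "\<beta> = a / (2 * K + 1)"

definition \<alpha> :: real where
  "\<alpha> = max (1 - a / 2) (max \<gamma> ((2 + \<beta> * (\<gamma> * R + 2 * K)) / (2 + \<beta> * R)))"

definition d :: "'a \<Rightarrow> 'a \<Rightarrow> real" where "d x y = 2 + \<beta> * V x + \<beta> * V y"

lemma \<beta>_pos: "0 < \<beta>" and \<beta>_K: "2 * \<beta> * K \<le> a"
  using a K by (auto simp: \<beta>_def field_simps)

lemma \<alpha>_bounds: "0 < \<alpha>" "\<alpha> < 1"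
proof -
  show "0 < \<alpha>" using a by (simp add: \<alpha>_def less_max_iff_disj)
  have "\<beta> * (\<gamma> * R + 2 * K) < \<beta> * R"
    using R \<beta>_pos by (intro mult_strict_left_mono) (auto simp: algebra_simps)
  then have "(2 + \<beta> * (\<gamma> * R + 2 * K)) / (2 + \<beta> * R) < 1"
    using \<beta>_pos R_pos by (simp add: divide_less_eq_1 add_pos_pos)
  then show "\<alpha> < 1" using a \<gamma> by (simp add: \<alpha>_def)
qed

text \<open>At \<open>S = R\<close> the last entry of the maximum defining \<alpha> gives the
  inequality. Both sides are affine in \<open>S\<close>, with slopes
  \<open>\<beta> * \<gamma>\<close> and \<open>\<beta> * \<alpha>\<close>, and \<gamma> is at most
  \<alpha>, so it persists beyond \<open>R\<close>.\<close>

lemma \<alpha>_large: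
  assumes "R \<le> S"
  shows "2 + \<beta> * (\<gamma> * S + 2 * K) \<le> \<alpha> * (2 + \<beta> * S)"
proof -
  define q where "q = (2 + \<beta> * (\<gamma> * R + 2 * K)) / (2 + \<beta> * R)"
  have pos: "0 < 2 + \<beta> * R" using \<beta>_pos R_pos by (simp add: add_pos_pos)
  have "q * (2 + \<beta> * R) = 2 + \<beta> * (\<gamma> * R + 2 * K)" unfolding q_def using pos by simp
  moreover have "\<gamma> * (\<beta> * (S - R)) \<le> \<alpha> * (\<beta> * (S - R))"
    using assms \<beta>_pos by (intro mult_right_mono) (auto simp: \<alpha>_def)
  moreover have "q * (2 + \<beta> * R) \<le> \<alpha> * (2 + \<beta> * R)"
    using pos by (intro mult_right_mono) (auto simp: \<alpha>_def q_def)
  ultimately show ?thesis by (simp add: algebra_simps)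
qed

text \<open>Since \<open>2 * \<beta> * K <= a\<close>, the constant term is at most
  \<open>2 - a = 2 * (1 - a / 2)\<close>, the source of the first entry of \<alpha>. The
  \<open>+ 1\<close> in the denominator of \<beta> covers \<open>K = 0\<close>.\<close>

lemma \<alpha>_small:
  assumes "0 \<le> S"
  shows "2 - 2 * a + \<beta> * (\<gamma> * S + 2 * K) \<le> \<alpha> * (2 + \<beta> * S)"
proof -
  have "(1 - a / 2) * 2 \<le> \<alpha> * 2" by (intro mult_right_mono) (auto simp: \<alpha>_def)
  moreover have "\<gamma> * (\<beta> * S) \<le> \<alpha> * (\<beta> * S)"
    using assms \<beta>_pos by (intro mult_right_mono) (auto simp: \<alpha>_def)
  ultimately show ?thesis using \<beta>_K by (simp add: algebra_simps)
qed

text \<open>Shifting \<open>\<phi>\<close> by a constant turns the bound on differences into \<open>\<bar>\<phi> + k\<bar> \<le> c (1 + \<beta> V) = W\<close>.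
  Applying the minorization to the nonnegative functions \<open>W - (\<phi> + k)\<close> under \<open>P x\<close> and
  \<open>W + (\<phi> + k)\<close> under \<open>P y\<close> and adding up cancels \<open>\<phi>\<close> under the minorizing measure.\<close>

lemma T_contraction:
  assumes \<phi>[measurable]: "\<phi> \<in> borel_measurable borel" and bdd: "\<And>u. \<bar>\<phi> u\<bar> \<le> B"
    and le: "\<And>u v. \<phi> u - \<phi> v \<le> c * d u v" and c: "0 \<le> c"
  shows "T \<phi> x - T \<phi> y \<le> \<alpha> * c * d x y"
proof -
  define W where "W = (\<lambda>u. c * (1 + \<beta> * V u))"
  \<comment> \<open>The seminorm bound says exactly that every value of \<open>\<phi> - W\<close>
    lies below every value of \<open>\<phi> + W\<close>. Any number separating the two ranges serves
    as \<open>- k\<close>; the supremum of the lower one is taken.\<close>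
  define k where "k = - (SUP u. \<phi> u - W u)"
  define h where "h = (\<lambda>u. \<phi> u + k)"
  have diff: "\<phi> u - W u \<le> \<phi> v + W v" for u v
    using le[of u v] by (simp add: W_def d_def algebra_simps)
  have "bdd_above (range (\<lambda>u. \<phi> u - W u))"
    using diff[of _ undefined] by (intro bdd_aboveI2) auto
  then have k1: "\<phi> u - W u \<le> - k" for u unfolding k_def minus_minus by (intro cSUP_upper) auto
  have k2: "- k \<le> \<phi> v + W v" for v unfolding k_def minus_minus by (rule cSUP_least) (use diff in auto)
  have h_le: "h u \<le> W u" "- W u \<le> h u" for u using k1[of u] k2[of u] by (auto simp: h_def)
  have [measurable]: "W \<in> borel_measurable borel" "h \<in> borel_measurable borel"
    by (auto simp: W_def h_def)
  have ints[simp]: "integrable (P z) \<phi>" "integrable (P z) W" "integrable (P z) h" for z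
  proof -
    interpret prob_space "P z" by (rule prob_P)
    show 1: "integrable (P z) \<phi>" by (rule integrable_bounded[OF prob_P]) (use bdd in auto)
    show "integrable (P z) W" unfolding W_def using V_int by simp
    show "integrable (P z) h" unfolding h_def using 1 by simp
  qed
  have W_le: "(\<integral>u. W u \<partial>P z) \<le> c * (1 + \<beta> * (\<gamma> * V z + K))" for z
  proof -
    interpret prob_space "P z" by (rule prob_P)
    have "(\<integral>u. W u \<partial>P z) = c * (1 + \<beta> * (\<integral>u. V u \<partial>P z))"
      unfolding W_def using V_int prob_space by simp
    also have "\<dots> \<le> c * (1 + \<beta> * (\<gamma> * V z + K))"
      using V_int_le[of z] \<beta>_pos c by (intro mult_left_mono add_left_mono) auto
    finally show ?thesis .
  qed
  have "(\<integral>u. h u \<partial>P z) = T \<phi> z + k" for z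
  proof -
    interpret prob_space "P z" by (rule prob_P)
    show ?thesis unfolding h_def T_def using prob_space by simp
  qed
  then have T_h: "T \<phi> x - T \<phi> y = (\<integral>u. h u \<partial>P x) - (\<integral>u. h u \<partial>P y)" by simp
  show ?thesis
  proof (cases "V x \<le> R \<and> V y \<le> R")
    case True
    interpret nu: prob_space \<nu> by (rule \<nu>)
    have "0 \<le> W u" for u using h_le[of u] by linarith
    then have W1: "integrable \<nu> W" using True by (intro minorization_integral(1)[of x]) auto
    have "0 \<le> W u - h u" "0 \<le> W u + h u" for u using h_le[of u] by linarith+
    then have 1: "integrable \<nu> (\<lambda>u. W u - h u)"
        "a * (\<integral>u. W u - h u \<partial>\<nu>) \<le> (\<integral>u. W u - h u \<partial>P x)"
      and 2: "integrable \<nu> (\<lambda>u. W u + h u)"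
        "a * (\<integral>u. W u + h u \<partial>\<nu>) \<le> (\<integral>u. W u + h u \<partial>P y)"
      using minorization_integral[of x "\<lambda>u. W u - h u"] minorization_integral[of y "\<lambda>u. W u + h u"] True
      by auto
    have h1: "integrable \<nu> h"
      using Bochner_Integration.integrable_diff[OF 2(1) W1] by simp
    \<comment> \<open>As \<open>V\<close> is nonnegative, \<open>W\<close> has mean at least
      \<open>c\<close> under \<nu>. This is the gain of \<open>2 * a * c\<close> against the plain
      drift estimate.\<close>
    have "c = (\<integral>u. c \<partial>\<nu>)" using nu.prob_space by simp
    also have "\<dots> \<le> (\<integral>u. W u \<partial>\<nu>)"
      using W1 c \<beta>_pos V_nonneg by (intro integral_mono) (auto simp: W_def mult_left_mono mult_le_cancel_left1)
    finally have "a * c \<le> a * (\<integral>u. W u \<partial>\<nu>)" using a by simp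
    then have "T \<phi> x - T \<phi> y \<le> (\<integral>u. W u \<partial>P x) + (\<integral>u. W u \<partial>P y) - 2 * (a * c)"
      using 1(2) 2(2) W1 h1 unfolding T_h by (simp add: algebra_simps)
    also have "\<dots> \<le> c * (2 - 2 * a + \<beta> * (\<gamma> * (V x + V y) + 2 * K))"
      using W_le[of x] W_le[of y] by (simp add: algebra_simps)
    also have "\<dots> \<le> c * (\<alpha> * (2 + \<beta> * (V x + V y)))"
      using c V_nonneg by (intro mult_left_mono \<alpha>_small) auto
    finally show ?thesis by (simp add: d_def algebra_simps)
  next
    case False
    then have S: "R \<le> V x + V y" using V_nonneg[of x] V_nonneg[of y] by linarith
    have "(\<integral>u. h u \<partial>P x) \<le> (\<integral>u. W u \<partial>P x)" "- (\<integral>u. W u \<partial>P y) \<le> (\<integral>u. h u \<partial>P y)"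
      using h_le by (auto intro!: integral_mono simp: Bochner_Integration.integral_minus[symmetric]
        simp del: Bochner_Integration.integral_minus)
    then have "T \<phi> x - T \<phi> y \<le> c * (2 + \<beta> * (\<gamma> * (V x + V y) + 2 * K))"
      using W_le[of x] W_le[of y] unfolding T_h by (simp add: algebra_simps)
    also have "\<dots> \<le> c * (\<alpha> * (2 + \<beta> * (V x + V y)))"
      using c S by (intro mult_left_mono \<alpha>_large) auto
    finally show ?thesis by (simp add: d_def algebra_simps)
  qed
qed

text \<open>The constant \<open>2\<close> in \<open>d\<close> is the largest oscillation of a
  function bounded by \<open>1\<close>, so the induction starts with seminorm at most
  \<open>1\<close>; each step multiplies it by \<alpha>.\<close>

lemma T_funpow_contraction:
  assumes \<phi>: "\<phi> \<in> borel_measurable borel" and bdd: "\<And>u. \<bar>\<phi> u\<bar> \<le> 1"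
  shows "\<bar>(T ^^ n) \<phi> x - (T ^^ n) \<phi> y\<bar> \<le> \<alpha> ^ n * d x y"
proof -
  have "(T ^^ n) \<phi> x - (T ^^ n) \<phi> y \<le> \<alpha> ^ n * d x y" for x y
  proof (induction n arbitrary: x y)
    case 0
    have "0 \<le> \<beta> * V x" "0 \<le> \<beta> * V y" using \<beta>_pos V_nonneg by simp_all
    moreover have "\<phi> x \<le> 1" "- \<phi> y \<le> 1" using bdd[of x] bdd[of y] by linarith+
    ultimately show ?case unfolding d_def by simp
  next
    case (Suc n)
    show ?case
      using T_contraction[OF T_funpow(1)[OF \<phi> bdd] T_funpow(2)[OF \<phi> bdd] Suc] \<alpha>_bounds by simp
  qed
  from this[of x y] this[of y x] show ?thesis by (simp add: d_def algebra_simps abs_le_iff)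
qed

section \<open>Moment bounds uniform in time and convergence of the iterates\<close>

lemma nn_integral_V_kernel_power:
  "(\<integral>\<^sup>+y. V y \<partial>kernel_power P n x) \<le> ennreal (V x + K / (1 - \<gamma>))"
proof (induction n)
  case 0
  have "0 \<le> K / (1 - \<gamma>)" using K \<gamma> by simp
  then show ?case by (simp add: nn_integral_return ennreal_leI del: ennreal_plus)
next
  case (Suc n)
  interpret prob_space "kernel_power P n x" by (rule prob_kernel_power)
  have K': "0 \<le> K / (1 - \<gamma>)" using K \<gamma> by simp
  have "(\<integral>\<^sup>+y. V y \<partial>kernel_power P (Suc n) x) = (\<integral>\<^sup>+y. \<integral>\<^sup>+z. V z \<partial>P y \<partial>kernel_power P n x)"
    by (simp, rule nn_integral_bind[where B=borel]) measurable
  also have "\<dots> \<le> (\<integral>\<^sup>+y. ennreal \<gamma> * ennreal (V y) + ennreal K \<partial>kernel_power P n x)"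
    using drift \<gamma> K V_nonneg by (intro nn_integral_mono) (simp add: ennreal_mult[symmetric] ennreal_plus[symmetric] del: ennreal_plus)
  also have "\<dots> = ennreal \<gamma> * (\<integral>\<^sup>+y. V y \<partial>kernel_power P n x) + ennreal K"
    using emeasure_space_1 by (simp add: nn_integral_add nn_integral_cmult)
  also have "\<dots> \<le> ennreal \<gamma> * ennreal (V x + K / (1 - \<gamma>)) + ennreal K"
    by (intro add_right_mono mult_left_mono Suc) auto
  also have "\<dots> = ennreal (\<gamma> * (V x + K / (1 - \<gamma>)) + K)"
    using \<gamma> K K' V_nonneg[of x] by (simp add: ennreal_mult[symmetric] ennreal_plus[symmetric] del: ennreal_plus)
  also have "\<dots> \<le> ennreal (V x + K / (1 - \<gamma>))"
  proof (rule ennreal_leI)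
    \<comment> \<open>\<open>K / (1 - \<gamma>)\<close> is the fixed point of the affine map
      \<open>t -> \<gamma> * t + K\<close>, so the bound reproduces itself at each step.\<close>
    have "\<gamma> * (K / (1 - \<gamma>)) + K = K / (1 - \<gamma>)" using \<gamma> by (simp add: field_simps)
    moreover have "\<gamma> * V x \<le> 1 * V x" using \<gamma> V_nonneg[of x] by (intro mult_right_mono) auto
    ultimately show "\<gamma> * (V x + K / (1 - \<gamma>)) + K \<le> V x + K / (1 - \<gamma>)"
      by (simp add: algebra_simps)
  qed
  finally show ?case .
qed

lemma V_kernel_power:
  shows "integrable (kernel_power P n x) V"
    and "(\<integral>y. V y \<partial>kernel_power P n x) \<le> V x + K / (1 - \<gamma>)"
proof -
  show *: "integrable (kernel_power P n x) V"
    by (rule integrableI_nonneg)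
      (use nn_integral_V_kernel_power[of n x] V_nonneg in \<open>auto simp: order_le_less_trans[OF _ ennreal_less_top]\<close>)
  have "0 \<le> K / (1 - \<gamma>)" using K \<gamma> by simp
  then show "(\<integral>y. V y \<partial>kernel_power P n x) \<le> V x + K / (1 - \<gamma>)"
    using nn_integral_V_kernel_power[of n x] nn_integral_eq_integral[OF * AE_I2[OF V_nonneg]] V_nonneg[of x]
    by (simp add: ennreal_le_iff del: ennreal_plus)
qed

text \<open>A bound, independent of \<open>m\<close>, for the mean of \<open>d y x\<close> when
  \<open>y\<close> is the state after \<open>m\<close> steps from \<open>x\<close>.\<close>

definition D :: "'a \<Rightarrow> real" where "D x = 2 + 2 * \<beta> * V x + \<beta> * (K / (1 - \<gamma>))"

text \<open>By the semigroup property the difference is the average of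
  \<open>(T ^^ n) \<phi> y - (T ^^ n) \<phi> x\<close> over the state \<open>y\<close> reached after
  \<open>m\<close> steps, and the contraction estimate can be integrated in
  \<open>y\<close>.\<close>

lemma T_funpow_cauchy:
  assumes \<phi>: "\<phi> \<in> borel_measurable borel" and bdd: "\<And>u. \<bar>\<phi> u\<bar> \<le> 1"
  shows "\<bar>(T ^^ (m + n)) \<phi> x - (T ^^ n) \<phi> x\<bar> \<le> \<alpha> ^ n * D x"
proof -
  let ?Q = "kernel_power P m x"
  interpret prob_space ?Q by (rule prob_kernel_power)
  let ?g = "(T ^^ n) \<phi>"
  have g[measurable]: "?g \<in> borel_measurable borel" and g1: "\<bar>?g u\<bar> \<le> 1" for u
    using T_funpow[OF \<phi> bdd] by auto
  have [simp]: "integrable ?Q ?g"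
    by (rule integrable_bounded[OF prob_kernel_power]) (use g g1 in auto)
  have [simp]: "integrable ?Q (\<lambda>y. d y x)" unfolding d_def using V_kernel_power(1) by simp
  have "(T ^^ (m + n)) \<phi> x - ?g x = (\<integral>y. ?g y - ?g x \<partial>?Q)"
    using integral_kernel_power[OF g g1, of m x] prob_space by (simp add: funpow_add)
  also have "\<bar>\<dots>\<bar> \<le> (\<integral>y. \<bar>?g y - ?g x\<bar> \<partial>?Q)" by (rule integral_abs_bound)
  also have "\<dots> \<le> (\<integral>y. \<alpha> ^ n * d y x \<partial>?Q)"
    by (intro integral_mono) (use T_funpow_contraction[OF \<phi> bdd] in auto)
  also have "\<dots> = \<alpha> ^ n * (2 + \<beta> * (\<integral>y. V y \<partial>?Q) + \<beta> * V x)"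
    unfolding d_def using V_kernel_power(1) prob_space by simp
  also have "\<dots> \<le> \<alpha> ^ n * D x"
  proof (intro mult_left_mono)
    have "\<beta> * (\<integral>y. V y \<partial>?Q) \<le> \<beta> * (V x + K / (1 - \<gamma>))"
      using V_kernel_power(2)[of m x] \<beta>_pos by (intro mult_left_mono) auto
    then show "2 + \<beta> * (\<integral>y. V y \<partial>?Q) + \<beta> * V x \<le> D x" by (simp add: D_def algebra_simps)
  qed (use \<alpha>_bounds in auto)
  finally show ?thesis .
qed

lemma measure_kernel_power:
  "A \<in> sets borel \<Longrightarrow> measure (kernel_power P n x) A = (T ^^ n) (indicator A) x"
  using integral_kernel_power[of "indicator A" 1 n x] by simp

text \<open>The limit is taken along the orbit of one arbitrary reference point. In the error,
  \<open>D x\<close> pays for comparing times \<open>n\<close> and \<open>m + n\<close>, and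
  \<open>d x undefined\<close> for comparing the two starting points at time
  \<open>m + n\<close>.\<close>

lemma exists_setwise_limit:
  obtains \<pi> where "prob_space \<pi>" "sets \<pi> = sets borel"
    "\<And>n x A. A \<in> sets borel \<Longrightarrow> \<bar>measure (kernel_power P n x) A - measure \<pi> A\<bar> \<le> \<alpha> ^ n * (D x + d x undefined)"
proof -
  define x0 :: 'a where "x0 = undefined"
  define L where "L A = lim (\<lambda>n. measure (kernel_power P n x0) A)" for A
  have ind: "indicator A \<in> borel_measurable borel" "\<bar>indicator A u\<bar> \<le> (1::real)" if "A \<in> sets borel" for A :: "'a set" and u
    using that by (auto simp: indicator_def)
  have pow0: "(\<lambda>n. \<alpha> ^ n) \<longlonglongrightarrow> 0" using \<alpha>_bounds by (intro LIMSEQ_power_zero) auto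
  have step: "\<bar>measure (kernel_power P (m + n) x) A - measure (kernel_power P n x) A\<bar> \<le> \<alpha> ^ n * D x"
    if "A \<in> sets borel" for A m n x
    using T_funpow_cauchy[OF ind[OF that]] that by (simp add: measure_kernel_power)
  have conv: "(\<lambda>n. measure (kernel_power P n x0) A) \<longlonglongrightarrow> L A" if A: "A \<in> sets borel" for A
  proof -
    have "Cauchy (\<lambda>n. measure (kernel_power P n x0) A)"
    proof (rule metric_CauchyI)
      fix e :: real assume "0 < e"
      have "(\<lambda>n. \<alpha> ^ n * D x0) \<longlonglongrightarrow> 0" using tendsto_mult_right[OF pow0, of "D x0"] by simp
      from order_tendstoD(2)[OF this, of "e / 2"] \<open>0 < e\<close>
      obtain N where N: "\<alpha> ^ N * D x0 < e / 2" unfolding eventually_sequentially by auto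
      have "dist (measure (kernel_power P m x0) A) (measure (kernel_power P N x0) A) < e / 2" if "m \<ge> N" for m
        using step[OF A, of "m - N" N x0] N that by (simp add: dist_real_def)
      then show "\<exists>M. \<forall>m\<ge>M. \<forall>n\<ge>M. dist (measure (kernel_power P m x0) A) (measure (kernel_power P n x0) A) < e"
        by (meson dist_triangle_half_l)
    qed
    then show ?thesis unfolding L_def by (simp add: Cauchy_convergent_iff convergent_LIMSEQ_iff)
  qed
  have x0: "\<bar>measure (kernel_power P n x0) A - L A\<bar> \<le> \<alpha> ^ n * D x0" if A: "A \<in> sets borel" for n A
  proof (rule LIMSEQ_le_const2)
    show "(\<lambda>m. \<bar>measure (kernel_power P n x0) A - measure (kernel_power P (m + n) x0) A\<bar>)
        \<longlonglongrightarrow> \<bar>measure (kernel_power P n x0) A - L A\<bar>"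
      by (intro tendsto_intros LIMSEQ_ignore_initial_segment conv A)
    show "\<exists>N. \<forall>m\<ge>N. \<bar>measure (kernel_power P n x0) A - measure (kernel_power P (m + n) x0) A\<bar> \<le> \<alpha> ^ n * D x0"
      using step[OF A] by (auto simp: abs_minus_commute)
  qed
  have lim_x: "\<bar>measure (kernel_power P n x) A - L A\<bar> \<le> \<alpha> ^ n * (D x + d x x0)" if A: "A \<in> sets borel" for n x A
  proof (rule LIMSEQ_le_const2)
    show "(\<lambda>m. \<bar>measure (kernel_power P n x) A - measure (kernel_power P (m + n) x0) A\<bar>)
        \<longlonglongrightarrow> \<bar>measure (kernel_power P n x) A - L A\<bar>"
      by (intro tendsto_intros LIMSEQ_ignore_initial_segment conv A)
    have "\<bar>measure (kernel_power P n x) A - measure (kernel_power P (m + n) x0) A\<bar> \<le> \<alpha> ^ n * (D x + d x x0)" for m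
    proof -
      have "\<bar>measure (kernel_power P (m + n) x) A - measure (kernel_power P (m + n) x0) A\<bar> \<le> \<alpha> ^ (m + n) * d x x0"
        using T_funpow_contraction[OF ind[OF A], of "m + n" x x0] A by (simp add: measure_kernel_power)
      \<comment> \<open>The power is weakened from \<open>m + n\<close> to \<open>n\<close> so that
        the bound no longer depends on \<open>m\<close>, which tends to infinity.\<close>
      also have "\<dots> \<le> \<alpha> ^ n * d x x0"
        using \<alpha>_bounds \<beta>_pos V_nonneg
        by (intro mult_right_mono power_decreasing) (auto simp: d_def intro!: add_nonneg_nonneg)
      finally show ?thesis using step[OF A, of m n x] by (simp add: algebra_simps)
    qed
    then show "\<exists>N. \<forall>m\<ge>N. \<bar>measure (kernel_power P n x) A - measure (kernel_power P (m + n) x0) A\<bar> \<le> \<alpha> ^ n * (D x + d x x0)"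
      by auto
  qed
  have "(\<lambda>n. \<alpha> ^ n * D x0) \<longlonglongrightarrow> 0" using tendsto_mult_right[OF pow0, of "D x0"] by simp
  from prob_space_of_setwise_limit[OF prob_kernel_power sets_kernel_power this x0]
  obtain \<pi> where "prob_space \<pi>" "sets \<pi> = sets borel" "\<And>A. A \<in> sets borel \<Longrightarrow> measure \<pi> A = L A"
    by metis
  then show ?thesis using lim_x by (intro that[of \<pi>]) (auto simp: x0_def)
qed

section \<open>Invariance, integrability of the Lyapunov function and total variation\<close>

theorem harris:
  "\<exists>\<pi>. invariant_prob P \<pi> \<and> integrable \<pi> V \<and>
    (\<exists>C>0. \<exists>r>0. \<forall>n x. tv_norm_diff (kernel_power P n x) \<pi> \<le> C * (1 + V x) * exp (- r * real n))"
proof -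
  define x0 :: 'a where "x0 = undefined"
  define E where "E x = D x + d x x0" for x
  obtain \<pi> where \<pi>: "prob_space \<pi>" "sets \<pi> = sets borel"
    and lim: "\<And>n x A. A \<in> sets borel \<Longrightarrow> \<bar>measure (kernel_power P n x) A - measure \<pi> A\<bar> \<le> \<alpha> ^ n * E x"
    using exists_setwise_limit unfolding E_def x0_def by metis
  interpret pi: prob_space \<pi> by (rule \<pi>)
  note [measurable_cong] = \<pi>(2)
  have space_\<pi>[simp]: "space \<pi> = UNIV" using sets_eq_imp_space_eq[OF \<pi>(2)] by simp
  have fun_lim: "\<bar>(\<integral>u. f u \<partial>kernel_power P n x) - (\<integral>u. f u \<partial>\<pi>)\<bar> \<le> \<alpha> ^ n * E x"
    if "f \<in> borel_measurable borel" "\<And>u. 0 \<le> f u" "\<And>u. f u \<le> 1" for f :: "'a \<Rightarrow> real" and n x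
    by (rule integral_diff_le_of_setwise[OF prob_kernel_power \<pi>(1)])
      (use that lim \<pi>(2) in \<open>auto simp: measurable_cong_sets[OF sets_kernel_power refl]\<close>)
  have pow0: "(\<lambda>n. \<alpha> ^ n * E x) \<longlonglongrightarrow> 0" for x
    using tendsto_mult_right[OF LIMSEQ_power_zero, of \<alpha> "E x"] \<alpha>_bounds by simp
  have tends: "(\<lambda>n. \<integral>u. f u \<partial>kernel_power P n x0) \<longlonglongrightarrow> (\<integral>u. f u \<partial>\<pi>)"
    if "f \<in> borel_measurable borel" "\<And>u. 0 \<le> f u" "\<And>u. f u \<le> 1" for f :: "'a \<Rightarrow> real"
    by (rule LIM_zero_cancel, rule tendsto_rabs_zero_cancel,
        rule tendsto_sandwich[OF _ _ tendsto_const pow0[of x0]])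
      (use fun_lim[OF that] in auto)
  \<comment> \<open>The mean of \<open>T (indicator A)\<close> after \<open>n\<close> steps is the
    mass of \<open>A\<close> after \<open>Suc n\<close> steps. Both sequences converge, as
    \<open>T (indicator A)\<close> is again measurable with values in \<open>[0, 1]\<close>, and
    they share their limit.\<close>
  have inv: "\<pi> \<bind> P = \<pi>"
  proof (rule measure_eqI)
    have bind_prob: "prob_space (\<pi> \<bind> P)"
      by (rule pi.prob_space_bind[where S=borel]) (auto simp: prob_P)
    show sets_bind: "sets (\<pi> \<bind> P) = sets \<pi>" using \<pi>(2) by (subst sets_bind[where N=borel]) auto
    interpret b: prob_space "\<pi> \<bind> P" by (rule bind_prob)
    fix A assume "A \<in> sets (\<pi> \<bind> P)"
    then have A[measurable]: "A \<in> sets borel" using sets_bind \<pi>(2) by simp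
    have ind: "indicator A \<in> borel_measurable borel" "\<bar>indicator A u\<bar> \<le> (1::real)" for u
      by (auto simp: indicator_def)
    have Tind: "T (indicator A) = (\<lambda>y. measure (P y) A)"
      by (auto simp: T_def)
    have T01: "0 \<le> T (indicator A) u" "T (indicator A) u \<le> 1" for u
      unfolding Tind using prob_space.prob_le_1[OF prob_P] by auto
    have "(\<lambda>n. \<integral>u. T (indicator A) u \<partial>kernel_power P n x0) \<longlonglongrightarrow> (\<integral>u. T (indicator A) u \<partial>\<pi>)"
      by (rule tends) (use T01 ind in auto)
    moreover have "(\<integral>u. T (indicator A) u \<partial>kernel_power P n x0) = (\<integral>u. indicat_real A u \<partial>kernel_power P (Suc n) x0)" for n
      using integral_bind_P[OF prob_kernel_power sets_kernel_power ind, of n x0] by simp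
    moreover have "(\<lambda>n. \<integral>u. indicat_real A u \<partial>kernel_power P n x0) \<longlonglongrightarrow> (\<integral>u. indicat_real A u \<partial>\<pi>)"
      by (rule tends) auto
    note LIMSEQ_Suc[OF this]
    ultimately have "(\<integral>u. T (indicator A) u \<partial>\<pi>) = (\<integral>u. indicat_real A u \<partial>\<pi>)"
      using LIMSEQ_unique by fastforce
    then have "measure (\<pi> \<bind> P) A = measure \<pi> A"
      using integral_bind_P[OF \<pi> ind] A sets_bind \<pi>(2) sets_eq_imp_space_eq[OF sets_bind] by simp
    then show "emeasure (\<pi> \<bind> P) A = emeasure \<pi> A"
      by (simp add: b.emeasure_eq_measure pi.emeasure_eq_measure)
  qed
  define B where "B = V x0 + K / (1 - \<gamma>)"
  have B: "0 \<le> B" using V_nonneg[of x0] K \<gamma> by (simp add: B_def)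
  \<comment> \<open>Convergence is available for \<open>[0, 1]\<close>-valued functions only, so
    \<open>V\<close> is cut off at \<open>m\<close> and divided by \<open>m\<close>; hence the
    separate case \<open>m = 0\<close>. Monotone convergence in \<open>m\<close> then removes the
    cutoff.\<close>
  have trunc: "(\<integral>u. min (V u) (real m) \<partial>\<pi>) \<le> B" for m
  proof (cases "m = 0")
    case False
    have "(\<lambda>n. \<integral>u. min (V u) (real m) / real m \<partial>kernel_power P n x0) \<longlonglongrightarrow> (\<integral>u. min (V u) (real m) / real m \<partial>\<pi>)"
      by (rule tends) (use False V_nonneg in auto)
    moreover have "(\<integral>u. min (V u) (real m) / real m \<partial>kernel_power P n x0) \<le> B / real m" for n
    proof -
      have "(\<integral>u. min (V u) (real m) \<partial>kernel_power P n x0) \<le> (\<integral>u. V u \<partial>kernel_power P n x0)"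
        using V_nonneg by (intro integral_mono V_kernel_power(1) integrable_bounded[OF prob_kernel_power, where B="real m"])
          (auto simp: abs_of_nonneg)
      also have "\<dots> \<le> B" unfolding B_def by (rule V_kernel_power(2))
      finally show ?thesis using False by (simp add: divide_right_mono)
    qed
    ultimately have "(\<integral>u. min (V u) (real m) / real m \<partial>\<pi>) \<le> B / real m"
      by (intro LIMSEQ_le_const2) auto
    then show ?thesis using False by (simp add: divide_le_cancel)
  qed (use B V_nonneg in \<open>simp add: min_absorb2\<close>)
  have "(\<integral>\<^sup>+u. V u \<partial>\<pi>) = (\<integral>\<^sup>+u. (SUP m. ennreal (min (V u) (real m))) \<partial>\<pi>)"
  proof (rule nn_integral_cong)
    fix u
    show "ennreal (V u) = (SUP m. ennreal (min (V u) (real m)))"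
    proof (rule antisym)
      obtain m where "V u \<le> real m" using real_arch_simple by blast
      then show "ennreal (V u) \<le> (SUP m. ennreal (min (V u) (real m)))"
        by (intro SUP_upper2[of m]) auto
    qed (auto intro!: SUP_least ennreal_leI)
  qed
  also have "\<dots> = (SUP m. \<integral>\<^sup>+u. ennreal (min (V u) (real m)) \<partial>\<pi>)"
    by (rule nn_integral_monotone_convergence_SUP) (auto simp: incseq_def le_fun_def intro!: ennreal_leI)
  also have "\<dots> \<le> ennreal B"
  proof (rule SUP_least)
    fix m
    have "(\<integral>\<^sup>+u. ennreal (min (V u) (real m)) \<partial>\<pi>) = ennreal (\<integral>u. min (V u) (real m) \<partial>\<pi>)"
      using V_nonneg by (intro nn_integral_eq_integral integrable_bounded[OF \<pi>, where B="real m"]) (auto simp: abs_of_nonneg)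
    then show "(\<integral>\<^sup>+u. ennreal (min (V u) (real m)) \<partial>\<pi>) \<le> ennreal B"
      using trunc[of m] by (simp add: ennreal_leI)
  qed
  finally have V\<pi>: "integrable \<pi> V"
    using V_nonneg by (intro integrableI_nonneg) (auto simp: order_le_less_trans[OF _ ennreal_less_top])
  have tv: "tv_norm_diff (kernel_power P n x) \<pi> \<le> 2 * (\<alpha> ^ n * E x)" for n x
    unfolding tv_norm_diff_def
  proof (rule cSUP_least)
    have "(\<lambda>_. 0 :: real) \<in> {f \<in> borel_measurable (kernel_power P n x). \<forall>x. \<bar>f x\<bar> \<le> 1}" by simp
    then show "{f \<in> borel_measurable (kernel_power P n x). \<forall>x. \<bar>f x\<bar> \<le> (1::real)} \<noteq> {}" by blast
    fix f :: "'a \<Rightarrow> real" assume "f \<in> {f \<in> borel_measurable (kernel_power P n x). \<forall>x. \<bar>f x\<bar> \<le> 1}"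
    then have f[measurable]: "f \<in> borel_measurable borel" and f1: "\<bar>f u\<bar> \<le> 1" for u
      by (auto simp: measurable_cong_sets[OF sets_kernel_power refl])
    interpret Q: prob_space "kernel_power P n x" by (rule prob_kernel_power)
    have int: "integrable (kernel_power P n x) f" "integrable \<pi> f"
      using integrable_bounded[OF prob_kernel_power sets_kernel_power f f1]
        integrable_bounded[OF \<pi> f f1] by auto
    \<comment> \<open>The map \<open>t -> (t + 1) / 2\<close> carries \<open>[-1, 1]\<close> to
      \<open>[0, 1]\<close> and halves differences of means. This is the origin of the factor
      \<open>2\<close>.\<close>
    have "\<bar>(\<integral>u. (f u + 1) / 2 \<partial>kernel_power P n x) - (\<integral>u. (f u + 1) / 2 \<partial>\<pi>)\<bar> \<le> \<alpha> ^ n * E x"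
    proof (rule fun_lim)
      show "0 \<le> (f u + 1) / 2" "(f u + 1) / 2 \<le> 1" for u using f1[of u] by (auto simp: abs_le_iff)
    qed simp
    then show "\<bar>(\<integral>u. f u \<partial>kernel_power P n x) - (\<integral>u. f u \<partial>\<pi>)\<bar> \<le> 2 * (\<alpha> ^ n * E x)"
      using int Q.prob_space pi.prob_space by (simp add: diff_divide_distrib[symmetric])
  qed
  \<comment> \<open>Expanded, \<open>E x\<close> is \<open>4 + 3 * \<beta> * V x\<close> plus two
    constants; \<open>C\<close> replaces \<open>V x\<close> by \<open>1\<close>, so
    \<open>2 * E x <= C * (1 + V x)\<close>. The rate is \<open>- ln \<alpha>\<close>.\<close>
  define C where "C = 2 * (4 + 3 * \<beta> + \<beta> * (K / (1 - \<gamma>)) + \<beta> * V x0)"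
  have c0: "0 \<le> \<beta> * (K / (1 - \<gamma>))" "0 \<le> \<beta> * V x0" using \<beta>_pos K \<gamma> V_nonneg by auto
  have "C > 0" unfolding C_def using c0 \<beta>_pos by simp
  moreover have "- ln \<alpha> > 0" using \<alpha>_bounds by simp
  moreover have "tv_norm_diff (kernel_power P n x) \<pi> \<le> C * (1 + V x) * exp (- (- ln \<alpha>) * real n)" for n x
  proof -
    have "2 * E x \<le> C * (1 + V x)"
    proof -
      have "2 * E x = 2 * (4 + \<beta> * (K / (1 - \<gamma>)) + \<beta> * V x0) + 2 * (3 * \<beta>) * V x"
        by (simp add: E_def D_def d_def algebra_simps)
      also have "\<dots> \<le> C + C * V x"
        using c0 \<beta>_pos V_nonneg[of x] by (intro add_mono mult_right_mono) (auto simp: C_def)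
      finally show ?thesis by (simp add: algebra_simps)
    qed
    then have "\<alpha> ^ n * (2 * E x) \<le> \<alpha> ^ n * (C * (1 + V x))"
      using \<alpha>_bounds by (intro mult_left_mono) auto
    moreover have "\<alpha> ^ n = exp (- (- ln \<alpha>) * real n)"
      using \<alpha>_bounds by (simp add: exp_of_nat2_mult exp_ln)
    ultimately show ?thesis using tv[of n x] by (simp add: algebra_simps)
  qed
  ultimately have "\<exists>C>0. \<exists>r>0. \<forall>n x. tv_norm_diff (kernel_power P n x) \<pi> \<le> C * (1 + V x) * exp (- r * real n)"
    by blast
  then show ?thesis using \<pi> inv V\<pi> unfolding invariant_prob_def by blast
qed

end

subsection \<open>Gaussian noise and random signs\<close>

lemma Basis_cart: "(Basis :: (real ^ 'd) set) = range (\<lambda>i. axis i 1)"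
  by (auto simp: Basis_vec_def)

lemma inj_axis_1: "inj (\<lambda>i :: 'd::finite. axis i (1 :: real))"
  by (auto simp: inj_def axis_eq_axis)

lemma prod_Basis_cart:
  fixes f :: "real ^ 'd \<Rightarrow> 'a::comm_monoid_mult"
  shows "(\<Prod>b\<in>Basis. f b) = (\<Prod>i\<in>UNIV. f (axis i 1))"
  unfolding Basis_cart by (subst prod.reindex[OF inj_axis_1]) simp

lemma nn_integral_std_normal: "(\<integral>\<^sup>+s. ennreal (std_normal_density s) \<partial>lborel) = 1"
  by (subst nn_integral_eq_integral) auto

lemma std_gaussian_sets[measurable_cong, simp]: "sets std_gaussian = sets borel"
  by (simp add: std_gaussian_def)

lemma std_gaussian_space[simp]: "space std_gaussian = UNIV"
  by (simp add: std_gaussian_def)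

lemma nn_integral_std_gaussian:
  "f \<in> borel_measurable borel \<Longrightarrow>
    (\<integral>\<^sup>+v. f v \<partial>std_gaussian) = (\<integral>\<^sup>+v. ennreal (\<Prod>i\<in>UNIV. std_normal_density (v $ i)) * f v \<partial>lborel)"
  unfolding std_gaussian_def by (subst nn_integral_density) auto

text \<open>The integrand is a product over \<open>Basis\<close>, so Tonelli for
  \<open>lborel\<close> splits it into one-dimensional integrals; all but the one belonging to
  \<open>i\<close> are total masses of a normal density.\<close>

lemma nn_integral_std_gaussian_component:
  fixes h :: "real \<Rightarrow> ennreal" and i :: "'d::finite"
  assumes [measurable]: "h \<in> borel_measurable borel"
  shows "(\<integral>\<^sup>+v. h (v $ i) \<partial>(std_gaussian :: (real ^ 'd) measure))
    = (\<integral>\<^sup>+s. ennreal (std_normal_density s) * h s \<partial>lborel)"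
proof -
  define f where "f b s = ennreal (std_normal_density s) * (if b = (axis i 1 :: real ^ 'd) then h s else 1)"
    for b s
  have "(\<integral>\<^sup>+v. h (v $ i) \<partial>(std_gaussian :: (real ^ 'd) measure))
      = (\<integral>\<^sup>+v. ennreal (\<Prod>j\<in>UNIV. std_normal_density (v $ j)) * h (v $ i) \<partial>(lborel :: (real ^ 'd) measure))"
    by (rule nn_integral_std_gaussian) measurable
  also have "\<dots> = (\<integral>\<^sup>+v. (\<Prod>b\<in>Basis. f b (v \<bullet> b)) \<partial>(lborel :: (real ^ 'd) measure))"
  proof (rule nn_integral_cong)
    fix v :: "real ^ 'd"
    have "(\<Prod>b\<in>Basis. f b (v \<bullet> b))
        = (\<Prod>j\<in>UNIV. ennreal (std_normal_density (v $ j)) * (if j = i then h (v $ i) else 1))"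
      unfolding prod_Basis_cart by (intro prod.cong) (auto simp: f_def inner_axis axis_eq_axis)
    also have "\<dots> = ennreal (\<Prod>j\<in>UNIV. std_normal_density (v $ j)) * h (v $ i)"
      by (simp add: prod.distrib prod_ennreal prod.delta)
    finally show "ennreal (\<Prod>j\<in>UNIV. std_normal_density (v $ j)) * h (v $ i) = (\<Prod>b\<in>Basis. f b (v \<bullet> b))" ..
  qed
  also have "\<dots> = (\<Prod>b\<in>Basis. \<integral>\<^sup>+s. f b s \<partial>lborel)"
    by (rule nn_integral_lborel_prod) (auto simp: f_def)
  also have "\<dots> = (\<Prod>j\<in>UNIV. if j = i then (\<integral>\<^sup>+s. ennreal (std_normal_density s) * h s \<partial>lborel) else 1)"
    unfolding prod_Basis_cart f_def
    by (intro prod.cong) (auto simp: axis_eq_axis nn_integral_std_normal)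
  also have "\<dots> = (\<integral>\<^sup>+s. ennreal (std_normal_density s) * h s \<partial>lborel)" by (simp add: prod.delta)
  finally show ?thesis .
qed

lemma prob_space_std_gaussian: "prob_space (std_gaussian :: (real ^ 'd) measure)"
proof (rule prob_spaceI)
  show "emeasure (std_gaussian :: (real ^ 'd) measure) (space std_gaussian) = 1"
    using nn_integral_std_gaussian_component[of "\<lambda>_. 1" "undefined :: 'd"]
    by (simp add: nn_integral_std_normal)
qed

section \<open>Exponential moments of the absolute value of a standard normal variable\<close>

definition abs_mgf :: "real \<Rightarrow> real" where
  "abs_mgf k = (\<integral>s. std_normal_density s * exp (k * \<bar>s\<bar>) \<partial>lborel)"

text \<open>Completing the square turns an exponentially tilted normal density into a multiple of a
  shifted one, and \<open>exp (k * |s|)\<close> is at most the sum of the tilts by \<open>k\<close>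
  and \<open>- k\<close>.\<close>

lemma integrable_abs_mgf: "integrable lborel (\<lambda>s. std_normal_density s * exp (k * \<bar>s\<bar>))"
proof -
  have eq: "std_normal_density s * exp (k * s) = exp (k\<^sup>2 / 2) * normal_density k 1 s" for k s :: real
  proof -
    have "- s\<^sup>2 / 2 + k * s = k\<^sup>2 / 2 + - (s - k)\<^sup>2 / 2" by (simp add: power2_eq_square field_simps)
    then have "exp (- s\<^sup>2 / 2) * exp (k * s) = exp (k\<^sup>2 / 2) * exp (- (s - k)\<^sup>2 / 2)"
      by (simp add: exp_add[symmetric])
    then show ?thesis by (simp add: normal_density_def field_simps)
  qed
  have int: "integrable lborel (\<lambda>s. std_normal_density s * exp (k * s))" for k
    unfolding eq by simp
  show ?thesis
  proof (rule Bochner_Integration.integrable_bound)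
    show "integrable lborel (\<lambda>s. std_normal_density s * exp (k * s) + std_normal_density s * exp (- k * s))"
      by (intro Bochner_Integration.integrable_add int)
    show "AE s in lborel. norm (std_normal_density s * exp (k * \<bar>s\<bar>))
        \<le> norm (std_normal_density s * exp (k * s) + std_normal_density s * exp (- k * s))"
    proof (rule AE_I2)
      fix s :: real
      have "0 \<le> std_normal_density s * exp (k * s)" "0 \<le> std_normal_density s * exp (- k * s)" by auto
      then show "norm (std_normal_density s * exp (k * \<bar>s\<bar>))
          \<le> norm (std_normal_density s * exp (k * s) + std_normal_density s * exp (- k * s))"
        by (cases "0 \<le> s") auto
    qed
  qed auto
qed

lemma abs_mgf_nonneg: "0 \<le> abs_mgf k"
  unfolding abs_mgf_def by (intro Bochner_Integration.integral_nonneg) auto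

text \<open>The integrand is below \<open>1\<close> except at the null set \<open>s = 0\<close>, so
  the inequality stays strict after integration. This is the source of contraction in the whole
  argument.\<close>

lemma abs_mgf_less_1:
  assumes "0 < k"
  shows "abs_mgf (- k) < 1"
proof -
  interpret N: prob_space "density lborel std_normal_density"
    by (rule prob_space_normal_density) simp
  have "(\<integral>s. exp (- k * \<bar>s\<bar>) \<partial>density lborel std_normal_density) < (\<integral>s. 1 \<partial>density lborel std_normal_density)"
  proof (rule N.integral_less_AE_space)
    show "integrable (density lborel std_normal_density) (\<lambda>s. exp (- k * \<bar>s\<bar>))"
      using integrable_abs_mgf[of "- k"] by (simp add: integrable_real_density)
    have "AE s in lborel. exp (- k * \<bar>s\<bar>) < 1"
      using AE_lborel_singleton[of "0::real"] assms by (auto elim!: eventually_mono)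
    then show "AE s in density lborel std_normal_density. exp (- k * \<bar>s\<bar>) < 1"
      by (subst AE_density) (auto elim!: eventually_mono)
  qed (use N.emeasure_space_1 in auto)
  moreover have "abs_mgf (- k) = (\<integral>s. exp (- k * \<bar>s\<bar>) \<partial>density lborel std_normal_density)"
    unfolding abs_mgf_def by (subst integral_real_density) auto
  ultimately show ?thesis using N.prob_space by simp
qed

lemma nn_integral_exp_component:
  fixes i :: "'d::finite"
  shows "(\<integral>\<^sup>+v. ennreal (exp (k * \<bar>v $ i\<bar>)) \<partial>(std_gaussian :: (real ^ 'd) measure)) = ennreal (abs_mgf k)"
proof -
  have "(\<integral>\<^sup>+v. ennreal (exp (k * \<bar>v $ i\<bar>)) \<partial>(std_gaussian :: (real ^ 'd) measure))
      = (\<integral>\<^sup>+s. ennreal (std_normal_density s) * ennreal (exp (k * \<bar>s\<bar>)) \<partial>lborel)"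
    by (rule nn_integral_std_gaussian_component) measurable
  also have "\<dots> = (\<integral>\<^sup>+s. ennreal (std_normal_density s * exp (k * \<bar>s\<bar>)) \<partial>lborel)"
    by (simp add: ennreal_mult)
  also have "\<dots> = ennreal (abs_mgf k)"
    unfolding abs_mgf_def by (rule nn_integral_eq_integral[OF integrable_abs_mgf]) auto
  finally show ?thesis .
qed

section \<open>Independent random signs\<close>

lemma pmf_sign_pmf:
  assumes "0 \<le> r" "r \<le> 1"
  shows "pmf (sign_pmf r) 1 = r" "pmf (sign_pmf r) (- 1) = 1 - r"
proof -
  have 1: "inj (\<lambda>b :: bool. if b then 1 else - 1 :: real)" by (auto simp: inj_def split: if_splits)
  show "pmf (sign_pmf r) 1 = r"
    using pmf_map_inj'[OF 1, of "bernoulli_pmf r" True] assms by (simp add: sign_pmf_def)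
  show "pmf (sign_pmf r) (- 1) = 1 - r"
    using pmf_map_inj'[OF 1, of "bernoulli_pmf r" False] assms by (simp add: sign_pmf_def)
qed

lemma set_sign_pmf: "set_pmf (sign_pmf r) \<subseteq> {1, - 1}"
  by (auto simp: sign_pmf_def)

lemma nn_integral_sign_pmf:
  assumes "0 \<le> r" "r \<le> 1"
  shows "(\<integral>\<^sup>+t. F t \<partial>sign_pmf r) = F 1 * ennreal r + F (- 1) * ennreal (1 - r)"
  using assms by (simp add: sign_pmf_def)

definition signs :: "('d::finite \<Rightarrow> real) set" where "signs = {b. \<forall>i. b i \<in> {1, - 1}}"

lemma finite_signs: "finite (signs :: ('d::finite \<Rightarrow> real) set)"
proof -
  have "signs = (PiE UNIV (\<lambda>_. {1, - 1}) :: ('d \<Rightarrow> real) set)"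
    by (auto simp: signs_def PiE_def Pi_def)
  then show ?thesis by (metis finite finite.emptyI finite.insertI finite_PiE)
qed

text \<open>With finite support the integral is a finite sum with explicit weights. Measurability in
  the parameters then becomes evident, and a lower bound may keep a single summand.\<close>

lemma nn_integral_Pi_sign_pmf:
  fixes r :: "'d::finite \<Rightarrow> real"
  assumes "\<And>i. 0 \<le> r i" "\<And>i. r i \<le> 1"
  shows "(\<integral>\<^sup>+b. F b \<partial>measure_pmf (Pi_pmf UNIV 0 (\<lambda>i. sign_pmf (r i))))
    = (\<Sum>b\<in>signs. F b * ennreal (\<Prod>i\<in>UNIV. if b i = 1 then r i else 1 - r i))"
proof -
  have "(\<integral>\<^sup>+b. F b \<partial>measure_pmf (Pi_pmf UNIV 0 (\<lambda>i. sign_pmf (r i))))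
      = (\<Sum>b\<in>signs. F b * ennreal (pmf (Pi_pmf UNIV 0 (\<lambda>i. sign_pmf (r i))) b))"
  proof (rule nn_integral_measure_pmf_support[OF finite_signs])
    fix b assume "b \<in> set_pmf (Pi_pmf UNIV 0 (\<lambda>i. sign_pmf (r i)))" "b \<notin> signs"
    then show "F b = 0"
      using set_sign_pmf by (fastforce simp: set_Pi_pmf PiE_dflt_def signs_def)
  qed auto
  also have "\<dots> = (\<Sum>b\<in>signs. F b * ennreal (\<Prod>i\<in>UNIV. if b i = 1 then r i else 1 - r i))"
  proof (rule sum.cong[OF refl])
    fix b :: "'d \<Rightarrow> real" assume b: "b \<in> signs"
    have "pmf (sign_pmf (r i)) (b i) = (if b i = 1 then r i else 1 - r i)" for i
      using b pmf_sign_pmf[OF assms(1) assms(2), of i] by (auto simp: signs_def)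
    then show "F b * ennreal (pmf (Pi_pmf UNIV 0 (\<lambda>i. sign_pmf (r i))) b)
        = F b * ennreal (\<Prod>i\<in>UNIV. if b i = 1 then r i else 1 - r i)"
      by (simp add: pmf_Pi)
  qed
  finally show ?thesis .
qed

lemma nn_integral_Pi_sign_pmf_component:
  fixes r :: "'d::finite \<Rightarrow> real"
  assumes "0 \<le> r i" "r i \<le> 1"
  shows "(\<integral>\<^sup>+b. F (b i) \<partial>measure_pmf (Pi_pmf UNIV 0 (\<lambda>i. sign_pmf (r i))))
    = F 1 * ennreal (r i) + F (- 1) * ennreal (1 - r i)"
proof -
  have "(\<integral>\<^sup>+b. F (b i) \<partial>measure_pmf (Pi_pmf UNIV 0 (\<lambda>i. sign_pmf (r i))))
      = (\<integral>\<^sup>+t. F t \<partial>measure_pmf (map_pmf (\<lambda>b. b i) (Pi_pmf UNIV 0 (\<lambda>i. sign_pmf (r i)))))"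
    by simp
  also have "\<dots> = (\<integral>\<^sup>+t. F t \<partial>sign_pmf (r i))" by (subst Pi_pmf_component) auto
  finally show ?thesis using nn_integral_sign_pmf[OF assms] by simp
qed

text \<open>With \<open>\<tau> = sgn \<xi>\<close>, the move \<open>\<tau> s\<close> points outwards exactly if it is positive. For
  \<open>\<bar>s\<bar> \<le> \<delta>\<close> nothing is known about \<open>q\<close>, and the last summand of the factor of \<open>exp \<bar>\<xi>\<bar>\<close> pays for this.\<close>

lemma pushed_step_bound:
  fixes q c s \<xi> \<tau> :: real
  assumes q: "0 \<le> q" "q \<le> 1" and c: "n \<le> c" "c \<le> m" "0 < n" and \<epsilon>: "0 \<le> \<epsilon>" and \<delta>: "0 \<le> \<delta>"
    and \<tau>: "\<tau> = 1 \<or> \<tau> = - 1" and \<xi>: "\<xi> = \<tau> * \<bar>\<xi>\<bar>"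
    and out: "\<tau> * s > \<delta> \<Longrightarrow> q \<le> \<epsilon>" and inw: "\<tau> * s < - \<delta> \<Longrightarrow> 1 - q \<le> \<epsilon>"
  shows "q * exp \<bar>\<xi> + c * s\<bar> + (1 - q) * exp \<bar>\<xi> - c * s\<bar>
    \<le> exp \<bar>\<xi>\<bar> * (exp (- n * \<bar>s\<bar>) + \<epsilon> * exp (m * \<bar>s\<bar>) + (exp (m * \<delta>) - exp (- n * \<delta>))) + exp (m * \<bar>s\<bar>)"
proof -
  define u where "u = \<tau> * s"
  have u: "\<bar>u\<bar> = \<bar>s\<bar>" using \<tau> by (auto simp: u_def)
  have s: "s = \<tau> * u" using \<tau> by (auto simp: u_def)
  have cu: "\<bar>c * u\<bar> \<le> m * \<bar>u\<bar>" using c by (simp add: abs_mult mult_right_mono)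
  \<comment> \<open>As long as \<open>|\<xi>| + t\<close> stays nonnegative the exponential
    factorises. Otherwise the origin is crossed, and the overshoot is at most
    \<open>m * |u|\<close>, whatever \<xi> is.\<close>
  have e: "exp \<bar>\<tau> * \<bar>\<xi>\<bar> + \<tau> * t\<bar> \<le> exp \<bar>\<xi>\<bar> * exp t + exp (m * \<bar>u\<bar>)" if "\<bar>t\<bar> = \<bar>c * u\<bar>" for t
  proof -
    have "\<bar>\<tau> * \<bar>\<xi>\<bar> + \<tau> * t\<bar> = \<bar>\<bar>\<xi>\<bar> + t\<bar>" using \<tau> by auto
    moreover have "exp \<bar>\<bar>\<xi>\<bar> + t\<bar> \<le> exp \<bar>\<xi>\<bar> * exp t + exp (m * \<bar>u\<bar>)"
    proof (cases "0 \<le> \<bar>\<xi>\<bar> + t")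
      case True
      then show ?thesis by (simp add: exp_add)
    next
      case False
      then have "\<bar>\<bar>\<xi>\<bar> + t\<bar> \<le> m * \<bar>u\<bar>" using cu that by linarith
      then show ?thesis by (simp add: add_increasing)
    qed
    ultimately show ?thesis by simp
  qed
  have "exp \<bar>\<xi> + c * s\<bar> \<le> exp \<bar>\<xi>\<bar> * exp (c * u) + exp (m * \<bar>u\<bar>)"
    using e[of "c * u"] \<xi> s by (simp add: mult.left_commute)
  moreover have "exp \<bar>\<xi> - c * s\<bar> \<le> exp \<bar>\<xi>\<bar> * exp (- c * u) + exp (m * \<bar>u\<bar>)"
    using e[of "- c * u"] \<xi> s by (simp add: mult.left_commute)
  ultimately have "q * exp \<bar>\<xi> + c * s\<bar> + (1 - q) * exp \<bar>\<xi> - c * s\<bar>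
      \<le> q * (exp \<bar>\<xi>\<bar> * exp (c * u) + exp (m * \<bar>u\<bar>)) + (1 - q) * (exp \<bar>\<xi>\<bar> * exp (- c * u) + exp (m * \<bar>u\<bar>))"
    using q by (intro add_mono mult_left_mono) auto
  also have "\<dots> = exp \<bar>\<xi>\<bar> * (q * exp (c * u) + (1 - q) * exp (- c * u)) + exp (m * \<bar>u\<bar>)"
    by (simp add: algebra_simps)
  also have "\<dots> \<le> exp \<bar>\<xi>\<bar> * (exp (- n * \<bar>u\<bar>) + \<epsilon> * exp (m * \<bar>u\<bar>) + (exp (m * \<delta>) - exp (- n * \<delta>))) + exp (m * \<bar>u\<bar>)"
  proof (intro add_right_mono mult_left_mono)
    have nd: "0 \<le> n * \<delta>" "0 \<le> m * \<delta>" using c \<delta> by auto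
    then have \<eta>: "0 \<le> exp (m * \<delta>) - exp (- n * \<delta>)" by simp
    consider "u > \<delta>" | "u < - \<delta>" | "\<bar>u\<bar> \<le> \<delta>" by linarith
    then show "q * exp (c * u) + (1 - q) * exp (- c * u)
        \<le> exp (- n * \<bar>u\<bar>) + \<epsilon> * exp (m * \<bar>u\<bar>) + (exp (m * \<delta>) - exp (- n * \<delta>))"
    proof cases
      case 1
      then have "q * exp (c * u) \<le> \<epsilon> * exp (m * \<bar>u\<bar>)"
        using out c \<delta> \<epsilon> q by (intro mult_mono) (auto simp: u_def mult_right_mono)
      moreover have "(1 - q) * exp (- c * u) \<le> 1 * exp (- n * \<bar>u\<bar>)"
        using 1 c \<delta> q by (intro mult_mono) (auto simp: mult_right_mono)
      ultimately show ?thesis using \<eta> by linarith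
    next
      case 2
      then have "(1 - q) * exp (- c * u) \<le> \<epsilon> * exp (m * \<bar>u\<bar>)"
        using inw c \<delta> \<epsilon> q by (intro mult_mono) (auto simp: u_def mult_right_mono_neg)
      moreover have "q * exp (c * u) \<le> 1 * exp (- n * \<bar>u\<bar>)"
        using 2 c \<delta> q by (intro mult_mono) (auto simp: mult_right_mono_neg)
      ultimately show ?thesis using \<eta> by linarith
    next
      case 3
      \<comment> \<open>Here both exponentials are at most \<open>exp (m * \<delta>)\<close>, while
        \<open>exp (- n * |u|)\<close> is at least \<open>exp (- n * \<delta>)\<close>. The extra
        summand is exactly the gap between these two values.\<close>
      have mu: "m * \<bar>u\<bar> \<le> m * \<delta>" using 3 c by (intro mult_left_mono) auto
      have "c * u \<le> m * \<delta>" "- c * u \<le> m * \<delta>" using cu mu by linarith+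
      then have "q * exp (c * u) + (1 - q) * exp (- c * u) \<le> q * exp (m * \<delta>) + (1 - q) * exp (m * \<delta>)"
        using q by (intro add_mono mult_left_mono) auto
      also have "\<dots> = exp (m * \<delta>)" by (simp add: algebra_simps)
      finally have "q * exp (c * u) + (1 - q) * exp (- c * u) \<le> exp (m * \<delta>)" .
      moreover have "exp (- n * \<delta>) \<le> exp (- n * \<bar>u\<bar>)" using 3 c by (simp add: mult_left_mono)
      moreover have "0 \<le> \<epsilon> * exp (m * \<bar>u\<bar>)" using \<epsilon> by simp
      ultimately show ?thesis by linarith
    qed
  qed simp
  finally show ?thesis unfolding u .
qed

subsection \<open>The skew-symmetric scheme with diagonal diffusion\<close>

text \<open>The norm is at most the sum of the absolute coordinates, so some coordinate carries at
  least its average share.\<close>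

lemma norm_cart_le: "\<exists>i. norm (x :: real ^ 'd) \<le> real CARD('d) * \<bar>x $ i\<bar>"
proof (rule ccontr)
  assume "\<not> ?thesis"
  then have *: "real CARD('d) * \<bar>x $ i\<bar> < norm x" for i by (simp add: not_le)
  have "real CARD('d) * norm x \<le> (\<Sum>i\<in>(UNIV :: 'd set). real CARD('d) * \<bar>x $ i\<bar>)"
    unfolding sum_distrib_left[symmetric] by (intro mult_left_mono norm_le_l1_cart) auto
  also have "\<dots> < (\<Sum>i\<in>(UNIV :: 'd set). norm x)" by (intro sum_strict_mono) (use * in auto)
  finally show False by simp
qed

lemma infnorm_cart_attained: "\<exists>i. infnorm (x :: real ^ 'd) = \<bar>x $ i\<bar>"
proof -
  have "infnorm x \<in> (\<lambda>b. \<bar>x \<bullet> b\<bar>) ` Basis"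
    unfolding infnorm_Max by (rule Max_in) auto
  then show ?thesis by (auto simp: Basis_cart inner_axis)
qed

text \<open>\<open>push\<close> condenses \<open>L3_pos\<close>, \<open>L3_neg\<close> and
  \<open>L4\<close>, and is the only trace of the drift. With \<tau> the sign of
  \<open>x $ i\<close>, it says that noise of size above \<delta> is turned inwards up to
  probability \<epsilon>. The radius \<open>r\<close> may depend on \<epsilon> and \<delta>, but not
  on the coordinate, the noise or the sign.\<close>

locale diagonal_skew =
  fixes dt :: real and \<sigma> :: "real ^ 'd \<Rightarrow> real ^ 'd ^ 'd"
    and p :: "'d \<Rightarrow> (real ^ 'd) \<times> (real ^ 'd) \<Rightarrow> real" and N M :: real
  assumes dt: "0 < dt"
    and \<sigma>_cont: "continuous_on UNIV (\<lambda>x. \<sigma> x $ i $ j)"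
    and p_cont: "continuous_on UNIV (p i)"
    and p01: "0 < p i (x, v)" "p i (x, v) < 1"
    and diag: "i \<noteq> j \<Longrightarrow> \<sigma> x $ i $ j = 0"
    and bounds: "0 < N" "N \<le> \<sigma> x $ i $ i" "\<sigma> x $ i $ i \<le> M"
    and push: "0 < \<epsilon> \<Longrightarrow> 0 < \<delta> \<Longrightarrow> \<exists>r. \<forall>x i v. \<forall>\<tau>\<in>{1, - 1}.
      r \<le> norm x \<longrightarrow> \<tau> * x $ i > infnorm x / 2 \<longrightarrow>
        (\<tau> * v $ i > \<delta> \<longrightarrow> p i (x, v) < \<epsilon>) \<and> (\<tau> * v $ i < - \<delta> \<longrightarrow> p i (x, v) > 1 - \<epsilon>)"
begin

section \<open>The one-step kernel as an explicit integral over noise and signs\<close>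

definition step :: "real ^ 'd \<Rightarrow> real ^ 'd \<Rightarrow> ('d \<Rightarrow> real) \<Rightarrow> real ^ 'd" where
  "step x v b = x + sqrt dt *\<^sub>R (\<sigma> x *v ((\<chi> i. b i) * v))"

definition sgn_measure :: "real ^ 'd \<Rightarrow> real ^ 'd \<Rightarrow> ('d \<Rightarrow> real) pmf" where
  "sgn_measure x v = Pi_pmf UNIV 0 (\<lambda>i. sign_pmf (p i (x, v)))"

definition n :: real where "n = sqrt dt * N"
definition m :: real where "m = sqrt dt * M"
definition c :: "real ^ 'd \<Rightarrow> 'd \<Rightarrow> real" where "c x i = sqrt dt * \<sigma> x $ i $ i"

lemma n_pos: "0 < n"
  using dt bounds(1) by (simp add: n_def)

lemma c_bounds: "n \<le> c x i" "c x i \<le> m"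
  using dt bounds by (auto simp: n_def m_def c_def)

lemma m_pos: "0 < m"
  using n_pos c_bounds[of undefined undefined] by linarith

lemma step_component: "step x v b $ i = x $ i + c x i * (b i * v $ i)"
proof -
  have "(\<sigma> x *v ((\<chi> i. b i) * v)) $ i = (\<Sum>j\<in>UNIV. if j = i then \<sigma> x $ i $ i * (b i * v $ i) else 0)"
    unfolding matrix_vector_mult_def vec_lambda_beta
    by (intro sum.cong) (auto simp: diag)
  then show ?thesis by (simp add: step_def c_def)
qed

lemma step_measurable[measurable]: "(\<lambda>(x, v). step x v b) \<in> borel \<Otimes>\<^sub>M borel \<rightarrow>\<^sub>M borel"
proof -
  have eq: "(\<lambda>(x, v). step x v b) = (\<lambda>z. \<chi> i. fst z $ i + sqrt dt * \<sigma> (fst z) $ i $ i * (b i * snd z $ i))"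
    by (auto simp: fun_eq_iff vec_eq_iff step_component c_def)
  have "continuous_on UNIV (\<lambda>z :: (real ^ 'd) \<times> (real ^ 'd). \<sigma> (fst z) $ i $ i)" for i
    by (rule continuous_on_compose2[OF \<sigma>_cont]) (auto intro!: continuous_intros)
  then have "continuous_on UNIV (\<lambda>(x, v). step x v b)"
    unfolding eq
    by (intro continuous_on_vec_lambda continuous_on_add continuous_on_mult continuous_on_const)
      (auto intro!: continuous_intros)
  then show ?thesis unfolding borel_prod by (rule borel_measurable_continuous_onI)
qed

lemma p_measurable[measurable]: "p i \<in> borel_measurable (borel \<Otimes>\<^sub>M borel)"
  unfolding borel_prod by (rule borel_measurable_continuous_onI[OF p_cont])

definition inner_kernel :: "real ^ 'd \<Rightarrow> real ^ 'd \<Rightarrow> (real ^ 'd) measure" where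
  "inner_kernel x v = distr (measure_pmf (sgn_measure x v)) borel (step x v)"

lemma skew_kernel_eq: "skew_kernel dt \<sigma> p x = std_gaussian \<bind> inner_kernel x"
  unfolding skew_kernel_def inner_kernel_def sgn_measure_def step_def ..

lemma nn_integral_sgn_measure:
  "(\<integral>\<^sup>+b. F b \<partial>measure_pmf (sgn_measure x v))
    = (\<Sum>b\<in>signs. F b * ennreal (\<Prod>i\<in>UNIV. if b i = 1 then p i (x, v) else 1 - p i (x, v)))"
  unfolding sgn_measure_def by (rule nn_integral_Pi_sign_pmf) (use p01 in \<open>auto simp: less_imp_le\<close>)

text \<open>The mass of a set is a finite sum over sign vectors of functions measurable in state and
  noise jointly. The joint form is what makes the mixture over the noise measurable in the
  state.\<close>

lemma inner_kernel_measurable[measurable]: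
  "(\<lambda>(x, v). inner_kernel x v) \<in> borel \<Otimes>\<^sub>M borel \<rightarrow>\<^sub>M prob_algebra borel"
proof (intro measurable_prob_algebraI measurable_subprob_algebra)
  have prob: "prob_space (inner_kernel x v)" for x v
    unfolding inner_kernel_def by (intro prob_space.prob_space_distr measure_pmf.prob_space_axioms) simp
  then show "prob_space (case z of (x, v) \<Rightarrow> inner_kernel x v)"
      "subprob_space (case z of (x, v) \<Rightarrow> inner_kernel x v)" for z
    by (auto split: prod.split intro: prob_space_imp_subprob_space)
  show "sets (case z of (x, v) \<Rightarrow> inner_kernel x v) = sets borel" for z
    by (auto simp: inner_kernel_def split: prod.split)
  fix A :: "(real ^ 'd) set" assume A[measurable]: "A \<in> sets borel"
  have "emeasure (inner_kernel x v) A = (\<integral>\<^sup>+b. indicator A (step x v b) \<partial>measure_pmf (sgn_measure x v))" for x v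
  proof -
    have "emeasure (inner_kernel x v) A = (\<integral>\<^sup>+y. indicator A y \<partial>inner_kernel x v)"
      by (simp add: inner_kernel_def)
    then show ?thesis unfolding inner_kernel_def by (simp add: nn_integral_distr del: nn_integral_indicator)
  qed
  then have eq: "(\<lambda>z. emeasure (case z of (x, v) \<Rightarrow> inner_kernel x v) A)
      = (\<lambda>z. \<Sum>b\<in>signs. indicator A (case z of (x, v) \<Rightarrow> step x v b)
          * ennreal (\<Prod>i\<in>UNIV. if b i = 1 then p i z else 1 - p i z))"
    by (auto simp: fun_eq_iff nn_integral_sgn_measure split: prod.split)
  show "(\<lambda>z. emeasure (case z of (x, v) \<Rightarrow> inner_kernel x v) A) \<in> borel_measurable (borel \<Otimes>\<^sub>M borel)"
    unfolding eq by measurable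
qed

lemma skew_kernel_measurable: "skew_kernel dt \<sigma> p \<in> borel \<rightarrow>\<^sub>M prob_algebra borel"
proof -
  have "(\<lambda>x. std_gaussian \<bind> inner_kernel x) \<in> borel \<rightarrow>\<^sub>M prob_algebra borel"
  proof (rule measurable_bind_prob_space2)
    show "(\<lambda>x. std_gaussian :: (real ^ 'd) measure) \<in> borel \<rightarrow>\<^sub>M prob_algebra borel"
      by (rule measurable_const) (simp add: space_prob_algebra prob_space_std_gaussian)
  qed (rule inner_kernel_measurable)
  then show ?thesis by (simp add: skew_kernel_eq[abs_def])
qed

lemma nn_integral_skew_kernel:
  assumes [measurable]: "f \<in> borel_measurable borel"
  shows "(\<integral>\<^sup>+y. f y \<partial>skew_kernel dt \<sigma> p x)
    = (\<integral>\<^sup>+v. (\<integral>\<^sup>+b. f (step x v b) \<partial>measure_pmf (sgn_measure x v)) \<partial>std_gaussian)"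
proof -
  have "inner_kernel x \<in> borel \<rightarrow>\<^sub>M prob_algebra borel"
    using measurable_Pair2[OF inner_kernel_measurable, of x] by simp
  then have "inner_kernel x \<in> std_gaussian \<rightarrow>\<^sub>M subprob_algebra borel"
    by (simp add: measurable_cong_sets[OF std_gaussian_sets refl] measurable_prob_algebraD)
  then have "(\<integral>\<^sup>+y. f y \<partial>skew_kernel dt \<sigma> p x) = (\<integral>\<^sup>+v. \<integral>\<^sup>+y. f y \<partial>inner_kernel x v \<partial>std_gaussian)"
    unfolding skew_kernel_eq by (intro nn_integral_bind[where B=borel]) auto
  then show ?thesis unfolding inner_kernel_def by (simp add: nn_integral_distr)
qed

section \<open>Exponential moments of one coordinate after one step\<close>

lemma coordinate_integral:
  "(\<integral>\<^sup>+y. ennreal (exp \<bar>y $ i\<bar>) \<partial>skew_kernel dt \<sigma> p x)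
    = (\<integral>\<^sup>+v. ennreal (p i (x, v) * exp \<bar>x $ i + c x i * v $ i\<bar>
        + (1 - p i (x, v)) * exp \<bar>x $ i - c x i * v $ i\<bar>) \<partial>std_gaussian)"
proof -
  \<comment> \<open>Coordinate \<open>i\<close> of the step depends on the sign vector through
    \<open>b i\<close> alone, so the remaining signs integrate out.\<close>
  have "(\<integral>\<^sup>+b. ennreal (exp \<bar>step x v b $ i\<bar>) \<partial>measure_pmf (sgn_measure x v))
      = ennreal (p i (x, v) * exp \<bar>x $ i + c x i * v $ i\<bar> + (1 - p i (x, v)) * exp \<bar>x $ i - c x i * v $ i\<bar>)" for v
    using nn_integral_Pi_sign_pmf_component[where r="\<lambda>i. p i (x, v)" and i=i
        and F="\<lambda>t. ennreal (exp \<bar>x $ i + c x i * (t * v $ i)\<bar>)"] p01(1)[of i x v] p01(2)[of i x v]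
    by (simp add: step_component sgn_measure_def ennreal_mult[symmetric] ennreal_plus[symmetric] mult.commute
        del: ennreal_plus)
  then show ?thesis by (subst nn_integral_skew_kernel) auto
qed

lemma nn_integral_exp_combination:
  fixes i :: 'd
  assumes "0 \<le> a1" "0 \<le> a2" "0 \<le> a3"
  shows "(\<integral>\<^sup>+v. ennreal (a1 * exp (k1 * \<bar>v $ i\<bar>) + a2 * exp (k2 * \<bar>v $ i\<bar>) + a3) \<partial>(std_gaussian :: (real ^ 'd) measure))
    = ennreal (a1 * abs_mgf k1 + a2 * abs_mgf k2 + a3)"
proof -
  have [simp]: "emeasure std_gaussian (UNIV :: (real ^ 'd) set) = 1"
    using prob_space.emeasure_space_1[OF prob_space_std_gaussian] by simp
  have "(\<integral>\<^sup>+v. ennreal (a1 * exp (k1 * \<bar>v $ i\<bar>) + a2 * exp (k2 * \<bar>v $ i\<bar>) + a3) \<partial>(std_gaussian :: (real ^ 'd) measure))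
    = (\<integral>\<^sup>+v. ennreal a1 * ennreal (exp (k1 * \<bar>v $ i\<bar>)) + ennreal a2 * ennreal (exp (k2 * \<bar>v $ i\<bar>)) + ennreal a3
        \<partial>(std_gaussian :: (real ^ 'd) measure))"
    using assms by (simp add: ennreal_mult ennreal_plus)
  also have "\<dots> = ennreal a1 * ennreal (abs_mgf k1) + ennreal a2 * ennreal (abs_mgf k2) + ennreal a3"
    by (simp add: nn_integral_add nn_integral_cmult nn_integral_exp_component)
  also have "\<dots> = ennreal (a1 * abs_mgf k1 + a2 * abs_mgf k2 + a3)"
    using assms abs_mgf_nonneg by (simp add: ennreal_mult ennreal_plus)
  finally show ?thesis .
qed

text \<open>A bound ignoring the direction of the move, for states near the origin and coordinates
  too small for \<open>push\<close>. The zero summands in the proof bring the integrand into the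
  shape of \<open>nn_integral_exp_combination\<close>.\<close>

lemma coordinate_crude:
  "(\<integral>\<^sup>+y. ennreal (exp \<bar>y $ i\<bar>) \<partial>skew_kernel dt \<sigma> p x) \<le> ennreal (exp \<bar>x $ i\<bar> * abs_mgf m)"
proof -
  have "(\<integral>\<^sup>+y. ennreal (exp \<bar>y $ i\<bar>) \<partial>skew_kernel dt \<sigma> p x)
      \<le> (\<integral>\<^sup>+v. ennreal (0 * exp (0 * \<bar>v $ i\<bar>) + exp \<bar>x $ i\<bar> * exp (m * \<bar>v $ i\<bar>) + 0) \<partial>std_gaussian)"
    unfolding coordinate_integral
  proof (intro nn_integral_mono ennreal_leI)
    fix v :: "real ^ 'd"
    have "\<bar>c x i * v $ i\<bar> \<le> m * \<bar>v $ i\<bar>"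
      using n_pos c_bounds[of x i] by (simp add: abs_mult mult_right_mono)
    then have "\<bar>x $ i + c x i * v $ i\<bar> \<le> \<bar>x $ i\<bar> + m * \<bar>v $ i\<bar>" "\<bar>x $ i - c x i * v $ i\<bar> \<le> \<bar>x $ i\<bar> + m * \<bar>v $ i\<bar>"
      by linarith+
    then have "exp \<bar>x $ i + c x i * v $ i\<bar> \<le> exp \<bar>x $ i\<bar> * exp (m * \<bar>v $ i\<bar>)"
      "exp \<bar>x $ i - c x i * v $ i\<bar> \<le> exp \<bar>x $ i\<bar> * exp (m * \<bar>v $ i\<bar>)"
      unfolding exp_add[symmetric] by simp_all
    from convex_bound_le[OF this, of "p i (x, v)" "1 - p i (x, v)"]
    show "p i (x, v) * exp \<bar>x $ i + c x i * v $ i\<bar> + (1 - p i (x, v)) * exp \<bar>x $ i - c x i * v $ i\<bar>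
        \<le> 0 * exp (0 * \<bar>v $ i\<bar>) + exp \<bar>x $ i\<bar> * exp (m * \<bar>v $ i\<bar>) + 0"
      using p01(1)[of i x v] p01(2)[of i x v] by simp
  qed
  also have "\<dots> = ennreal (exp \<bar>x $ i\<bar> * abs_mgf m)"
    by (subst nn_integral_exp_combination) auto
  finally show ?thesis .
qed

lemma coordinate_pushed:
  assumes \<epsilon>: "0 \<le> \<epsilon>" and \<delta>: "0 \<le> \<delta>" and \<tau>: "\<tau> \<in> {1, - 1}" and x: "\<tau> * x $ i > 0"
    and out: "\<And>v. \<tau> * v $ i > \<delta> \<Longrightarrow> p i (x, v) < \<epsilon>"
    and inw: "\<And>v. \<tau> * v $ i < - \<delta> \<Longrightarrow> p i (x, v) > 1 - \<epsilon>"
  shows "(\<integral>\<^sup>+y. ennreal (exp \<bar>y $ i\<bar>) \<partial>skew_kernel dt \<sigma> p x)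
    \<le> ennreal (exp \<bar>x $ i\<bar> * (abs_mgf (- n) + \<epsilon> * abs_mgf m + (exp (m * \<delta>) - exp (- n * \<delta>))) + abs_mgf m)"
proof -
  let ?\<eta> = "exp (m * \<delta>) - exp (- n * \<delta>)"
  have "0 \<le> n * \<delta>" "0 \<le> m * \<delta>" using n_pos m_pos \<delta> by auto
  then have \<eta>: "0 \<le> ?\<eta>" by simp
  have "x $ i = \<tau> * \<bar>x $ i\<bar>" using \<tau> x by auto
  then have "(\<integral>\<^sup>+y. ennreal (exp \<bar>y $ i\<bar>) \<partial>skew_kernel dt \<sigma> p x)
      \<le> (\<integral>\<^sup>+v. ennreal (exp \<bar>x $ i\<bar> * exp (- n * \<bar>v $ i\<bar>) + (exp \<bar>x $ i\<bar> * \<epsilon> + 1) * exp (m * \<bar>v $ i\<bar>) + exp \<bar>x $ i\<bar> * ?\<eta>)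
          \<partial>std_gaussian)"
    unfolding coordinate_integral
  proof (intro nn_integral_mono ennreal_leI, goal_cases)
    case (1 v)
    have "p i (x, v) * exp \<bar>x $ i + c x i * v $ i\<bar> + (1 - p i (x, v)) * exp \<bar>x $ i - c x i * v $ i\<bar>
        \<le> exp \<bar>x $ i\<bar> * (exp (- n * \<bar>v $ i\<bar>) + \<epsilon> * exp (m * \<bar>v $ i\<bar>) + ?\<eta>) + exp (m * \<bar>v $ i\<bar>)"
      by (rule pushed_step_bound[OF _ _ c_bounds n_pos \<epsilon> \<delta> _ 1(1)])
        (use p01[of i x v] \<tau> out[of v] inw[of v] in auto)
    then show ?case by (simp add: algebra_simps)
  qed
  also have "\<dots> = ennreal (exp \<bar>x $ i\<bar> * abs_mgf (- n) + (exp \<bar>x $ i\<bar> * \<epsilon> + 1) * abs_mgf m + exp \<bar>x $ i\<bar> * ?\<eta>)"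
    using \<epsilon> \<eta> by (intro nn_integral_exp_combination) auto
  finally show ?thesis by (simp add: algebra_simps)
qed

lemma coordinate_drift:
  "\<exists>\<kappa> C. 0 \<le> \<kappa> \<and> \<kappa> < 1 \<and> 0 \<le> C \<and> (\<forall>x i. (\<integral>\<^sup>+y. ennreal (exp \<bar>y $ i\<bar>) \<partial>skew_kernel dt \<sigma> p x)
    \<le> ennreal (\<kappa> * exp \<bar>x $ i\<bar> + C * (1 + exp (infnorm x / 2))))"
proof -
  define \<kappa>0 K0 where "\<kappa>0 = abs_mgf (- n)" and "K0 = abs_mgf m"
  have \<kappa>0: "0 \<le> \<kappa>0" "\<kappa>0 < 1" and K0: "0 \<le> K0"
    using abs_mgf_less_1[OF n_pos] abs_mgf_nonneg by (auto simp: \<kappa>0_def K0_def)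
  \<comment> \<open>The gap \<open>1 - \<kappa>0\<close> is split: wrong signs may use one quarter
    of it through \<epsilon>, small noise another quarter through \<delta>. This leaves the factor
    \<open>\<kappa> = \<kappa>0 + (1 - \<kappa>0) / 2\<close>.\<close>
  define \<epsilon> where "\<epsilon> = (1 - \<kappa>0) / (4 * (K0 + 1))"
  have \<epsilon>: "0 < \<epsilon>" using \<kappa>0 K0 by (simp add: \<epsilon>_def)
  have \<epsilon>K0: "\<epsilon> * K0 \<le> (1 - \<kappa>0) / 4"
  proof -
    have "\<epsilon> * K0 \<le> \<epsilon> * (K0 + 1)" using \<epsilon> by simp
    also have "\<dots> = (1 - \<kappa>0) / 4" using K0 by (simp add: \<epsilon>_def field_simps)
    finally show ?thesis .
  qed
  have "((\<lambda>\<delta>. exp (m * \<delta>) - exp (- n * \<delta>)) \<longlongrightarrow> exp (m * 0) - exp (- n * 0)) (at_right 0)"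
    by (intro tendsto_intros)
  then have "eventually (\<lambda>\<delta>. exp (m * \<delta>) - exp (- n * \<delta>) < (1 - \<kappa>0) / 4) (at_right 0)"
    using \<kappa>0 by (intro order_tendstoD) auto
  then have "eventually (\<lambda>\<delta>. 0 < \<delta> \<and> exp (m * \<delta>) - exp (- n * \<delta>) < (1 - \<kappa>0) / 4) (at_right 0)"
    using eventually_at_right_less[of 0] by eventually_elim auto
  from eventually_happens[OF this] obtain \<delta> where \<delta>: "0 < \<delta>" "exp (m * \<delta>) - exp (- n * \<delta>) < (1 - \<kappa>0) / 4"
    by (auto simp: trivial_limit_at_right_real)
  obtain r where r: "\<And>x i v \<tau>. \<tau> \<in> {1, - 1} \<Longrightarrow> r \<le> norm x \<Longrightarrow> \<tau> * x $ i > infnorm x / 2 \<Longrightarrow>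
      (\<tau> * v $ i > \<delta> \<longrightarrow> p i (x, v) < \<epsilon>) \<and> (\<tau> * v $ i < - \<delta> \<longrightarrow> p i (x, v) > 1 - \<epsilon>)"
    using push[OF \<epsilon> \<delta>(1)] by meson
  define \<kappa> where "\<kappa> = (1 + \<kappa>0) / 2"
  \<comment> \<open>The summand \<open>exp r\<close> covers states of norm below \<open>r\<close> by
    the crude bound; the summand \<open>1\<close> covers the small coordinates and the overshoot
    term.\<close>
  define C where "C = K0 * (exp r + 1)"
  have \<kappa>: "0 \<le> \<kappa>" "\<kappa> < 1" using \<kappa>0 by (auto simp: \<kappa>_def)
  have C: "0 \<le> C" "K0 \<le> C" "K0 * exp r \<le> C" using K0 by (auto simp: C_def algebra_simps)
  have "(\<integral>\<^sup>+y. ennreal (exp \<bar>y $ i\<bar>) \<partial>skew_kernel dt \<sigma> p x)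
      \<le> ennreal (\<kappa> * exp \<bar>x $ i\<bar> + C * (1 + exp (infnorm x / 2)))" for x i
  proof -
    have Ce: "0 \<le> C * exp (infnorm x / 2)" "0 \<le> \<kappa> * exp \<bar>x $ i\<bar>" using C \<kappa> by auto
    consider "norm x < r" | "\<bar>x $ i\<bar> \<le> infnorm x / 2" | "r \<le> norm x" "\<bar>x $ i\<bar> > infnorm x / 2" by linarith
    then show ?thesis
    proof cases
      case 1
      have "\<bar>x $ i\<bar> \<le> norm x" by (rule component_le_norm_cart)
      then have "exp \<bar>x $ i\<bar> \<le> exp r" using 1 by simp
      then have "exp \<bar>x $ i\<bar> * K0 \<le> C"
        using C(3) K0 mult_right_mono[of "exp \<bar>x $ i\<bar>" "exp r" K0] by (simp add: mult.commute)
      then have "exp \<bar>x $ i\<bar> * abs_mgf m \<le> \<kappa> * exp \<bar>x $ i\<bar> + C * (1 + exp (infnorm x / 2))"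
        using Ce by (simp add: K0_def algebra_simps)
      then show ?thesis by (rule order.trans[OF coordinate_crude ennreal_leI])
    next
      case 2
      then have "exp \<bar>x $ i\<bar> * K0 \<le> exp (infnorm x / 2) * C" using C K0 by (intro mult_mono) auto
      then have "exp \<bar>x $ i\<bar> * abs_mgf m \<le> \<kappa> * exp \<bar>x $ i\<bar> + C * (1 + exp (infnorm x / 2))"
        using Ce C by (simp add: K0_def algebra_simps)
      then show ?thesis by (rule order.trans[OF coordinate_crude ennreal_leI])
    next
      case 3
      define \<tau> :: real where "\<tau> = (if x $ i > 0 then 1 else - 1)"
      have \<tau>: "\<tau> \<in> {1, - 1}" "\<tau> * x $ i > infnorm x / 2"
        using 3 by (auto simp: \<tau>_def)
      have pos: "\<tau> * x $ i > 0" using \<tau>(2) infnorm_pos_le[of x] by linarith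
      have "(\<integral>\<^sup>+y. ennreal (exp \<bar>y $ i\<bar>) \<partial>skew_kernel dt \<sigma> p x)
        \<le> ennreal (exp \<bar>x $ i\<bar> * (abs_mgf (- n) + \<epsilon> * abs_mgf m + (exp (m * \<delta>) - exp (- n * \<delta>))) + abs_mgf m)"
        by (rule coordinate_pushed[OF _ _ \<tau>(1) pos]) (use \<epsilon> \<delta> r[OF \<tau>(1) 3(1) \<tau>(2)] in auto)
      also have "\<dots> \<le> ennreal (\<kappa> * exp \<bar>x $ i\<bar> + C * (1 + exp (infnorm x / 2)))"
      proof (rule ennreal_leI)
        have "\<kappa>0 + \<epsilon> * K0 + (exp (m * \<delta>) - exp (- n * \<delta>)) \<le> \<kappa>"
          using \<epsilon>K0 \<delta>(2) by (simp add: \<kappa>_def field_simps)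
        then have "exp \<bar>x $ i\<bar> * (\<kappa>0 + \<epsilon> * K0 + (exp (m * \<delta>) - exp (- n * \<delta>))) \<le> exp \<bar>x $ i\<bar> * \<kappa>"
          by (intro mult_left_mono) auto
        then show "exp \<bar>x $ i\<bar> * (abs_mgf (- n) + \<epsilon> * abs_mgf m + (exp (m * \<delta>) - exp (- n * \<delta>))) + abs_mgf m
            \<le> \<kappa> * exp \<bar>x $ i\<bar> + C * (1 + exp (infnorm x / 2))"
          using Ce C(1,2) unfolding \<kappa>0_def K0_def distrib_left mult_1_right mult.commute[of \<kappa>] by linarith
      qed
      finally show ?thesis .
    qed
  qed
  then show ?thesis using \<kappa> C by blast
qed

section \<open>The Lyapunov function and its drift\<close>

definition V :: "real ^ 'd \<Rightarrow> real" where "V x = (\<Sum>i\<in>UNIV. exp \<bar>x $ i\<bar>)"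

lemma V_measurable[measurable]: "V \<in> borel_measurable borel"
  unfolding V_def by measurable

lemma exp_component_le_V: "exp \<bar>x $ i\<bar> \<le> V x"
  unfolding V_def by (rule member_le_sum) auto

lemma V_ge_1: "1 \<le> V x"
  using exp_component_le_V[of x undefined] one_le_exp_iff[of "\<bar>x $ undefined\<bar>"] by linarith

text \<open>The estimate \<open>(1 + t / k) ^ k <= exp t\<close>, applied to a coordinate comparable
  with the norm, makes integrability of \<open>V\<close> imply moments of every order.\<close>

lemma norm_power_le_V: "norm x ^ k \<le> (real CARD('d) * real (Suc k)) ^ k * V x"
proof (cases "k = 0")
  case False
  obtain i where i: "norm x \<le> real CARD('d) * \<bar>x $ i\<bar>" using norm_cart_le by blast
  have "(\<bar>x $ i\<bar> / real k) ^ k \<le> (1 + \<bar>x $ i\<bar> / real k) ^ k" by (intro power_mono) auto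
  also have "\<dots> \<le> exp \<bar>x $ i\<bar>" using False by (intro exp_ge_one_plus_x_over_n_power_n) auto
  finally have 1: "(\<bar>x $ i\<bar> / real k) ^ k \<le> V x" using exp_component_le_V[of x i] by linarith
  have "norm x ^ k \<le> (real CARD('d) * \<bar>x $ i\<bar>) ^ k" using i by (intro power_mono) auto
  also have "\<dots> = (real CARD('d) * real k) ^ k * (\<bar>x $ i\<bar> / real k) ^ k"
    using False by (simp add: power_mult_distrib[symmetric])
  also have "\<dots> \<le> (real CARD('d) * real (Suc k)) ^ k * V x"
    using 1 by (intro mult_mono power_mono) auto
  finally show ?thesis .
qed (use V_ge_1 in simp)

text \<open>Coordinates with \<open>\<bar>x\<^sub>i\<bar> \<le> \<parallel>x\<parallel>\<^sub>\<infinity> / 2\<close> may be pushed outwards, but they contribute only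
  \<open>exp (\<parallel>x\<parallel>\<^sub>\<infinity> / 2) \<le> sqrt (V x)\<close>, which is absorbed into the contraction of the large ones.\<close>

lemma drift:
  "\<exists>\<gamma> K. 0 \<le> \<gamma> \<and> \<gamma> < 1 \<and> 0 \<le> K \<and> (\<forall>x. (\<integral>\<^sup>+y. ennreal (V y) \<partial>skew_kernel dt \<sigma> p x) \<le> ennreal (\<gamma> * V x + K))"
proof -
  obtain \<kappa> C where \<kappa>: "0 \<le> \<kappa>" "\<kappa> < 1" and C: "0 \<le> C" and coord: "\<And>x i.
      (\<integral>\<^sup>+y. ennreal (exp \<bar>y $ i\<bar>) \<partial>skew_kernel dt \<sigma> p x) \<le> ennreal (\<kappa> * exp \<bar>x $ i\<bar> + C * (1 + exp (infnorm x / 2)))"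
    using coordinate_drift by blast
  define E where "E = real CARD('d) * C"
  have E: "0 \<le> E" using C by (simp add: E_def)
  \<comment> \<open>\<gamma> is halfway between \<kappa> and \<open>1\<close>. The spare
    \<open>(1 - \<kappa>) / 2 * V x\<close> dominates \<open>(1 - \<kappa>) / 2 * u\<^sup>2\<close>
    with \<open>u = exp (infnorm x / 2)\<close>, and completing the square in \<open>u\<close>
    against \<open>E * u\<close> leaves the second summand of \<open>K\<close>.\<close>
  define \<gamma> K where "\<gamma> = (1 + \<kappa>) / 2" and "K = E + E\<^sup>2 / (2 * (1 - \<kappa>))"
  have sets[measurable_cong]: "sets (skew_kernel dt \<sigma> p x) = sets borel" for x
    using measurable_space[OF skew_kernel_measurable, of x] by (simp add: space_prob_algebra)
  have "(\<integral>\<^sup>+y. ennreal (V y) \<partial>skew_kernel dt \<sigma> p x) \<le> ennreal (\<gamma> * V x + K)" for x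
  proof -
    have "(\<integral>\<^sup>+y. ennreal (V y) \<partial>skew_kernel dt \<sigma> p x)
        = (\<integral>\<^sup>+y. (\<Sum>i\<in>UNIV. ennreal (exp \<bar>y $ i\<bar>)) \<partial>skew_kernel dt \<sigma> p x)"
      by (simp add: V_def sum_ennreal)
    also have "\<dots> = (\<Sum>i\<in>UNIV. \<integral>\<^sup>+y. ennreal (exp \<bar>y $ i\<bar>) \<partial>skew_kernel dt \<sigma> p x)"
      by (rule nn_integral_sum) measurable
    also have "\<dots> \<le> (\<Sum>i\<in>UNIV. ennreal (\<kappa> * exp \<bar>x $ i\<bar> + C * (1 + exp (infnorm x / 2))))"
      by (intro sum_mono coord)
    also have "\<dots> = ennreal (\<kappa> * V x + E * (1 + exp (infnorm x / 2)))"
      using \<kappa> C by (subst sum_ennreal) (auto simp: V_def E_def sum.distrib sum_distrib_left add_nonneg_nonneg mult.assoc)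
    also have "\<dots> \<le> ennreal (\<gamma> * V x + K)"
    proof (rule ennreal_leI)
      let ?u = "exp (infnorm x / 2)"
      obtain i where "infnorm x = \<bar>x $ i\<bar>" using infnorm_cart_attained by blast
      then have "?u\<^sup>2 \<le> V x"
        using exp_component_le_V[of x i] by (simp add: power2_eq_square exp_add[symmetric])
      then have "(1 - \<kappa>) / 2 * ?u\<^sup>2 \<le> (1 - \<kappa>) / 2 * V x" using \<kappa> by (intro mult_left_mono) auto
      moreover have "0 \<le> (1 - \<kappa>) / 2 * (?u - E / (1 - \<kappa>))\<^sup>2" using \<kappa> by simp
      moreover have "(1 - \<kappa>) / 2 * (?u - E / (1 - \<kappa>))\<^sup>2 = (1 - \<kappa>) / 2 * ?u\<^sup>2 - E * ?u + E\<^sup>2 / (2 * (1 - \<kappa>))"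
      proof -
        define w where "w = 1 - \<kappa>"
        have "w \<noteq> 0" using \<kappa> by (simp add: w_def)
        then show ?thesis unfolding w_def[symmetric] by (simp add: power2_eq_square field_simps)
      qed
      moreover have "\<gamma> * V x = \<kappa> * V x + (1 - \<kappa>) / 2 * V x" by (simp add: \<gamma>_def field_simps)
      ultimately show "\<kappa> * V x + E * (1 + ?u) \<le> \<gamma> * V x + K"
        unfolding K_def distrib_left by linarith
    qed
    finally show ?thesis .
  qed
  moreover have "0 \<le> \<gamma>" "\<gamma> < 1" "0 \<le> K" using \<kappa> E by (auto simp: \<gamma>_def K_def)
  ultimately show ?thesis by blast
qed

section \<open>Minorization on sublevel sets\<close>

lemma emeasure_step_vimage:
  assumes [measurable]: "S \<in> sets borel"
  shows "emeasure lborel S \<le> ennreal (m ^ CARD('d)) * (\<integral>\<^sup>+v. indicator S (step x v (\<lambda>_. 1)) \<partial>lborel)"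
proof -
  \<comment> \<open>The affine change of variables for \<open>lborel\<close> is indexed by
    \<open>Basis\<close>; \<open>k\<close> transports the coordinate scales there. The description
    is unambiguous because distinct indices have distinct axis vectors.\<close>
  define k where "k b = c x (THE i. b = axis i (1 :: real))" for b :: "real ^ 'd"
  have k: "k (axis i 1) = c x i" for i by (simp add: k_def axis_eq_axis)
  have k0: "k b \<noteq> 0" if "b \<in> Basis" for b
    using that by (auto simp: Basis_cart k) (metis n_pos c_bounds(1) not_le)
  have step_eq: "step x v (\<lambda>_. 1) = x + (\<Sum>j\<in>Basis. (k j * (v \<bullet> j)) *\<^sub>R j)" for v
  proof -
    have "(\<Sum>j\<in>Basis. (k j * (v \<bullet> j)) *\<^sub>R j) $ i = c x i * v $ i" for i
    proof -
      have "(\<Sum>j\<in>Basis. (k j * (v \<bullet> j)) *\<^sub>R j) $ i = (\<Sum>j\<in>UNIV. (c x j * v $ j) *\<^sub>R axis j 1) $ i"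
        unfolding Basis_cart by (subst sum.reindex[OF inj_axis_1]) (simp add: k inner_axis)
      also have "\<dots> = (\<Sum>j\<in>UNIV. if j = i then c x i * v $ i else 0)"
        unfolding sum_component by (intro sum.cong) (auto simp: axis_def)
      finally show ?thesis by simp
    qed
    then show ?thesis by (simp add: vec_eq_iff step_component)
  qed
  have [measurable]: "(\<lambda>v. step x v (\<lambda>_. 1)) \<in> borel \<rightarrow>\<^sub>M borel"
    using measurable_Pair2[OF step_measurable, of x "\<lambda>_. 1"] by simp
  have prod: "(\<Prod>j\<in>Basis. \<bar>k j\<bar>) = (\<Prod>i\<in>UNIV. \<bar>c x i\<bar>)"
    by (simp add: prod_Basis_cart k)
  \<comment> \<open>For fixed \<open>x\<close> and all signs \<open>+1\<close> the step is affine in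
    the noise with diagonal linear part, and its Jacobian is the product of the scales, each at most
    \<open>m\<close>.\<close>
  have "emeasure lborel S = emeasure (density (distr lborel borel (\<lambda>v. step x v (\<lambda>_. 1))) (\<lambda>_. \<Prod>j\<in>Basis. \<bar>k j\<bar>)) S"
    unfolding step_eq by (subst lborel_affine_euclidean[where c=k and t=x, OF k0]) auto
  also have "\<dots> = ennreal (\<Prod>i\<in>UNIV. \<bar>c x i\<bar>) * (\<integral>\<^sup>+v. indicator S (step x v (\<lambda>_. 1)) \<partial>lborel)"
  proof -
    have "emeasure (distr lborel borel (\<lambda>v. step x v (\<lambda>_. 1))) S
        = (\<integral>\<^sup>+y. indicator S y \<partial>distr lborel borel (\<lambda>v. step x v (\<lambda>_. 1)))" by simp
    also have "\<dots> = (\<integral>\<^sup>+v. indicator S (step x v (\<lambda>_. 1)) \<partial>lborel)"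
      by (rule nn_integral_distr) auto
    finally show ?thesis unfolding prod by (simp add: emeasure_density nn_integral_cmult)
  qed
  also have "\<dots> \<le> ennreal (m ^ CARD('d)) * (\<integral>\<^sup>+v. indicator S (step x v (\<lambda>_. 1)) \<partial>lborel)"
  proof (intro mult_right_mono ennreal_leI)
    have "(\<Prod>i\<in>(UNIV :: 'd set). \<bar>c x i\<bar>) \<le> (\<Prod>i\<in>(UNIV :: 'd set). m)"
    proof (intro prod_mono conjI)
      show "\<bar>c x i\<bar> \<le> m" for i using n_pos c_bounds[of x i] by linarith
    qed auto
    then show "(\<Prod>i\<in>(UNIV :: 'd set). \<bar>c x i\<bar>) \<le> m ^ CARD('d)" by simp
  qed auto
  finally show ?thesis .
qed

text \<open>Each \<open>p i\<close> is continuous and positive, hence attains a positive minimum on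
  a compact product of balls; there are finitely many \<open>i\<close>. For negative
  \<open>B\<close> the claim is vacuous.\<close>

lemma uniform_lower_bound:
  "\<exists>e>0. \<forall>i x v. norm x \<le> B \<longrightarrow> norm v \<le> B \<longrightarrow> e \<le> p i (x, v)"
proof (cases "0 \<le> B")
  case True
  have "\<exists>e>0. \<forall>x v. norm x \<le> B \<longrightarrow> norm v \<le> B \<longrightarrow> e \<le> p i (x, v)" for i
  proof -
    let ?S = "cball (0 :: real ^ 'd) B \<times> cball (0 :: real ^ 'd) B"
    have "\<exists>z\<in>?S. \<forall>w\<in>?S. p i z \<le> p i w"
      by (rule continuous_attains_inf)
        (use True p_cont[of i] continuous_on_subset in \<open>auto intro!: compact_Times\<close>)
    then obtain x v where "\<And>w. w \<in> ?S \<Longrightarrow> p i (x, v) \<le> p i w" by auto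
    then show ?thesis using p01(1)[of i x v] by (intro exI[of _ "p i (x, v)"]) auto
  qed
  then obtain e where e: "\<And>i. 0 < e i" "\<And>i x v. norm x \<le> B \<Longrightarrow> norm v \<le> B \<Longrightarrow> e i \<le> p i (x, v)"
    by metis
  have "0 < Min (range e)" using e(1) by simp
  moreover have "Min (range e) \<le> p i (x, v)" if "norm x \<le> B" "norm v \<le> B" for i x v
    by (rule order.trans[OF Min_le e(2)[OF that]]) auto
  ultimately show ?thesis by blast
next
  case False
  then have "\<not> norm (x :: real ^ 'd) \<le> B" for x using norm_ge_zero[of x] by linarith
  then show ?thesis by (intro exI[of _ 1]) auto
qed

text \<open>Only the event that all signs are \<open>+1\<close> is used.\<close>

lemma minorization:
  "\<exists>a>0. a \<le> 1 \<and> (\<forall>x A. V x \<le> R \<longrightarrow> A \<in> sets borel \<longrightarrow>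
    a * measure (uniform_measure lborel (cball (0 :: real ^ 'd) 1)) A \<le> measure (skew_kernel dt \<sigma> p x) A)"
proof -
  \<comment> \<open>If the step lands in the unit ball and \<open>|x $ i| <= |R|\<close>, then
    \<open>c x i * v $ i\<close> has size at most \<open>1 + |R|\<close>. As the scale is at least
    \<open>n\<close>, \<open>B\<close> bounds the noise coordinates; \<open>Bn\<close> converts
    coordinate bounds into norm bounds.\<close>
  define B where "B = (1 + \<bar>R\<bar>) / n"
  define Bn where "Bn = real CARD('d) * max \<bar>R\<bar> B"
  have B: "0 < B" using n_pos by (simp add: B_def)
  obtain e where e: "0 < e" "\<And>i x v. norm x \<le> Bn \<Longrightarrow> norm v \<le> Bn \<Longrightarrow> e \<le> p i (x, v)"
    using uniform_lower_bound[of Bn] by blast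
  define q where "q = (e * std_normal_density B) ^ CARD('d)"
  have q: "0 < q" using e(1) normal_density_pos[of 1 0 B] by (simp add: q_def)
  let ?D = "cball (0 :: real ^ 'd) 1"
  let ?\<nu> = "uniform_measure lborel ?D"
  have [measurable]: "?D \<in> sets borel" by simp
  have D0: "emeasure lborel ?D \<noteq> 0" "emeasure lborel ?D \<noteq> \<infinity>"
    using content_cball_pos[of 1 "0 :: real ^ 'd"] emeasure_lborel_cball_finite[of "0 :: real ^ 'd" 1]
    by (auto simp: measure_def)
  define l where "l = measure lborel ?D"
  have l: "0 < l" "emeasure lborel ?D = ennreal l"
    using D0 emeasure_eq_ennreal_measure[of lborel ?D] by (auto simp: l_def zero_less_measure_iff)
  \<comment> \<open>\<open>q\<close> bounds from below the noise density times the probability of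
    all signs \<open>+1\<close>. Dividing by the maximal Jacobian passes to a density in the target,
    and \<open>l\<close> undoes the normalisation of the uniform measure.\<close>
  define a where "a = min 1 (q * l / m ^ CARD('d))"
  have a: "0 < a" "a \<le> 1" using q l m_pos by (auto simp: a_def)
  have "a * measure ?\<nu> A \<le> measure (skew_kernel dt \<sigma> p x) A"
    if x: "V x \<le> R" and A[measurable]: "A \<in> sets borel" for x A
  proof -
    have Px: "prob_space (skew_kernel dt \<sigma> p x)" and sets[measurable_cong]: "sets (skew_kernel dt \<sigma> p x) = sets borel"
      using measurable_space[OF skew_kernel_measurable, of x] by (auto simp: space_prob_algebra)
    interpret P: prob_space "skew_kernel dt \<sigma> p x" by (rule Px)
    have xi: "\<bar>x $ i\<bar> \<le> \<bar>R\<bar>" for i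
      using exp_component_le_V[of x i] exp_ge_add_one_self[of "\<bar>x $ i\<bar>"] x by linarith
    have norm_le: "norm z \<le> Bn" if "\<And>i. \<bar>z $ i\<bar> \<le> max \<bar>R\<bar> B" for z :: "real ^ 'd"
    proof -
      have "norm z \<le> (\<Sum>i\<in>UNIV. \<bar>z $ i\<bar>)" by (rule norm_le_l1_cart)
      also have "\<dots> \<le> (\<Sum>i\<in>(UNIV :: 'd set). max \<bar>R\<bar> B)" by (intro sum_mono that)
      finally show ?thesis by (simp add: Bn_def)
    qed
    let ?w = "\<lambda>v. (\<Prod>i\<in>UNIV. std_normal_density (v $ i)) * (\<Prod>i\<in>UNIV. p i (x, v))"
    have low: "q \<le> ?w v" if "step x v (\<lambda>_. 1) \<in> ?D" for v
    proof -
      have vi: "\<bar>v $ i\<bar> \<le> B" for i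
      proof -
        have "\<bar>x $ i + c x i * v $ i\<bar> \<le> 1"
          using that component_le_norm_cart[of "step x v (\<lambda>_. 1)" i] by (simp add: step_component)
        then have "\<bar>c x i * v $ i\<bar> \<le> 1 + \<bar>R\<bar>" using xi[of i] by linarith
        moreover have "n * \<bar>v $ i\<bar> \<le> \<bar>c x i * v $ i\<bar>"
          using n_pos c_bounds[of x i] by (simp add: abs_mult mult_right_mono)
        ultimately show ?thesis using n_pos by (simp add: B_def field_simps)
      qed
      have "norm v \<le> Bn" "norm x \<le> Bn" using vi xi by (auto intro!: norm_le simp: le_max_iff_disj)
      then have pe: "e \<le> p i (x, v)" for i using e(2) by simp
      have "std_normal_density B \<le> std_normal_density (v $ i)" for i
        using vi[of i] B by (simp add: normal_density_def abs_le_square_iff[symmetric] divide_right_mono)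
      then have "(\<Prod>i\<in>(UNIV :: 'd set). e * std_normal_density B)
          \<le> (\<Prod>i\<in>UNIV. p i (x, v) * std_normal_density (v $ i))"
        using e(1) pe by (intro prod_mono conjI mult_mono) (auto simp: order.trans[OF less_imp_le[OF e(1)]])
      then show ?thesis by (simp add: q_def prod.distrib mult.commute)
    qed
    have [measurable]: "(\<lambda>v. step x v b) \<in> borel \<rightarrow>\<^sub>M borel" for b
      using measurable_Pair2[OF step_measurable, of x b] by simp
    have [measurable]: "(\<lambda>v. p i (x, v)) \<in> borel_measurable borel" for i
      using measurable_Pair2[OF p_measurable, of x i] by simp
    let ?J = "\<integral>\<^sup>+v. indicator (A \<inter> ?D) (step x v (\<lambda>_. 1)) \<partial>(lborel :: (real ^ 'd) measure)"
    have "ennreal q * ?J = (\<integral>\<^sup>+v. ennreal q * indicator (A \<inter> ?D) (step x v (\<lambda>_. 1)) \<partial>lborel)"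
      by (rule nn_integral_cmult[symmetric]) measurable
    also have "\<dots> \<le> (\<integral>\<^sup>+v. ennreal (?w v) * indicator A (step x v (\<lambda>_. 1)) \<partial>lborel)"
      using low by (intro nn_integral_mono) (auto split: split_indicator intro!: ennreal_leI)
    also have "\<dots> = (\<integral>\<^sup>+v. ennreal (\<Prod>i\<in>UNIV. std_normal_density (v $ i)) *
        (indicator A (step x v (\<lambda>_. 1)) * ennreal (\<Prod>i\<in>UNIV. p i (x, v))) \<partial>lborel)"
      using p01 by (intro nn_integral_cong) (simp add: ennreal_mult prod_nonneg less_imp_le ac_simps)
    also have "\<dots> = (\<integral>\<^sup>+v. indicator A (step x v (\<lambda>_. 1)) * ennreal (\<Prod>i\<in>UNIV. p i (x, v)) \<partial>std_gaussian)"
      by (rule nn_integral_std_gaussian[symmetric]) measurable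
    also have "\<dots> \<le> (\<integral>\<^sup>+v. (\<integral>\<^sup>+b. indicator A (step x v b) \<partial>measure_pmf (sgn_measure x v)) \<partial>std_gaussian)"
    proof (rule nn_integral_mono)
      fix v :: "real ^ 'd"
      have "(\<lambda>_. 1) \<in> (signs :: ('d \<Rightarrow> real) set)" by (simp add: signs_def)
      then show "indicator A (step x v (\<lambda>_. 1)) * ennreal (\<Prod>i\<in>UNIV. p i (x, v))
          \<le> (\<integral>\<^sup>+b. indicator A (step x v b) \<partial>measure_pmf (sgn_measure x v))"
        unfolding nn_integral_sgn_measure
        by (intro order.trans[OF _ member_le_sum[OF _ _ finite_signs]]) auto
    qed
    also have "\<dots> = emeasure (skew_kernel dt \<sigma> p x) A"
      by (subst nn_integral_skew_kernel[symmetric]) (auto simp: sets)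
    finally have J: "ennreal q * ?J \<le> ennreal (measure (skew_kernel dt \<sigma> p x) A)"
      by (simp add: P.emeasure_eq_measure)
    have "emeasure lborel (A \<inter> ?D) \<le> emeasure lborel ?D" by (rule emeasure_mono) auto
    then have fin: "emeasure lborel (A \<inter> ?D) = ennreal (measure lborel (A \<inter> ?D))"
      using D0 by (intro emeasure_eq_ennreal_measure) (auto simp: top_unique)
    have "ennreal q * emeasure lborel (A \<inter> ?D) \<le> ennreal q * (ennreal (m ^ CARD('d)) * ?J)"
      by (intro mult_left_mono emeasure_step_vimage) auto
    also have "\<dots> = ennreal (m ^ CARD('d)) * (ennreal q * ?J)" by (simp add: ac_simps)
    also have "\<dots> \<le> ennreal (m ^ CARD('d)) * ennreal (measure (skew_kernel dt \<sigma> p x) A)"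
      by (intro mult_left_mono J) auto
    finally have "q * measure lborel (A \<inter> ?D) \<le> m ^ CARD('d) * measure (skew_kernel dt \<sigma> p x) A"
      using q m_pos unfolding fin by (simp add: ennreal_mult[symmetric])
    moreover define z where "z = measure ?\<nu> A"
    moreover have "measure lborel (A \<inter> ?D) = z * l"
      using measure_uniform_measure[OF D0, of A] l(1) by (simp add: z_def l_def Int_commute)
    ultimately have "q * l / m ^ CARD('d) * z \<le> measure (skew_kernel dt \<sigma> p x) A"
      using m_pos by (simp add: field_simps)
    moreover have "a * z \<le> q * l / m ^ CARD('d) * z"
      by (intro mult_right_mono) (auto simp: a_def z_def)
    ultimately show ?thesis unfolding z_def by linarith
  qed
  then show ?thesis using a by blast
qed

section \<open>Harris' theorem applied to the scheme\<close>

theorem geometric_ergodicity: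
  "\<exists>\<pi>. invariant_prob (skew_kernel dt \<sigma> p) \<pi> \<and> (\<forall>k::nat. integrable \<pi> (\<lambda>x. norm x ^ k)) \<and>
    (\<exists>C>0. \<exists>r>0. \<exists>W :: real ^ 'd \<Rightarrow> real. (\<forall>x. 1 \<le> W x) \<and>
      (\<forall>k x. tv_norm_diff (kernel_power (skew_kernel dt \<sigma> p) k x) \<pi> \<le> C * W x * exp (- r * real k)))"
proof -
  obtain \<gamma> K where \<gamma>K: "0 \<le> \<gamma>" "\<gamma> < 1" "0 \<le> K"
      "\<And>x. (\<integral>\<^sup>+y. ennreal (V y) \<partial>skew_kernel dt \<sigma> p x) \<le> ennreal (\<gamma> * V x + K)"
    using drift by blast
  \<comment> \<open>The drift fixes the threshold \<open>2 * K / (1 - \<gamma>)\<close>, and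
    \<open>R\<close> lies just above it. The choice is free because the minorization holds on every
    sublevel set of \<open>V\<close>.\<close>
  define R where "R = 2 * K / (1 - \<gamma>) + 1"
  obtain a where a: "0 < a" "a \<le> 1" and minor: "\<And>x A. V x \<le> R \<Longrightarrow> A \<in> sets borel \<Longrightarrow>
      a * measure (uniform_measure lborel (cball (0 :: real ^ 'd) 1)) A \<le> measure (skew_kernel dt \<sigma> p x) A"
    using minorization[of R] by blast
  have prob: "prob_space (uniform_measure lborel (cball (0 :: real ^ 'd) 1))"
    using content_cball_pos[of 1 "0 :: real ^ 'd"] emeasure_lborel_cball_finite[of "0 :: real ^ 'd" 1]
    by (intro prob_space_uniform_measure) (auto simp: measure_def)
  have R: "2 * K < (1 - \<gamma>) * R" using \<gamma>K(2) by (simp add: R_def distrib_left)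
  have V0: "0 \<le> V x" for x using V_ge_1[of x] by linarith
  interpret harris_kernel "skew_kernel dt \<sigma> p" V \<gamma> K R a "uniform_measure lborel (cball 0 1)"
    by (rule harris_kernel.intro)
      (rule skew_kernel_measurable V_measurable V0 \<gamma>K R a prob minor | assumption | simp)+
  obtain \<pi> C r where \<pi>: "invariant_prob (skew_kernel dt \<sigma> p) \<pi>" "integrable \<pi> V" and "0 < C" "0 < r"
    and tv: "\<And>k x. tv_norm_diff (kernel_power (skew_kernel dt \<sigma> p) k x) \<pi> \<le> C * (1 + V x) * exp (- r * real k)"
    using harris by blast
  have [measurable_cong]: "sets \<pi> = sets borel" using \<pi>(1) by (simp add: invariant_prob_def)
  have moments: "integrable \<pi> (\<lambda>x. norm x ^ k)" for k :: nat
  proof (rule Bochner_Integration.integrable_bound)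
    show "integrable \<pi> (\<lambda>x. (real CARD('d) * real (Suc k)) ^ k * V x)" using \<pi>(2) by simp
    show "AE x in \<pi>. norm (norm x ^ k) \<le> norm ((real CARD('d) * real (Suc k)) ^ k * V x)"
    proof (rule AE_I2)
      fix x
      show "norm (norm x ^ k) \<le> norm ((real CARD('d) * real (Suc k)) ^ k * V x)"
        using norm_power_le_V[of x k] V0[of x] by simp
    qed
  qed measurable
  have W: "1 \<le> 1 + V x" for x using V0[of x] by simp
  have "\<exists>W :: real ^ 'd \<Rightarrow> real. (\<forall>x. 1 \<le> W x) \<and>
      (\<forall>k x. tv_norm_diff (kernel_power (skew_kernel dt \<sigma> p) k x) \<pi> \<le> C * W x * exp (- r * real k))"
    by (rule exI[of _ "\<lambda>x. 1 + V x"]) (intro conjI allI W tv)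
  then show ?thesis using \<pi>(1) moments \<open>0 < C\<close> \<open>0 < r\<close> by blast
qed

end

section \<open>Reduction of the stated assumptions to the abstract scheme\<close>

lemma C_k_continuous: "C_k l f \<Longrightarrow> continuous_on UNIV f"
  by (cases l) auto

theorem theorem4p1:
  fixes dt :: real
    and \<mu> :: "real ^ 'd \<Rightarrow> real ^ 'd"
    and \<sigma> :: "real ^ 'd \<Rightarrow> real ^ 'd ^ 'd"
    and p :: "'d \<Rightarrow> (real ^ 'd) \<times> (real ^ 'd) \<Rightarrow> real"
  assumes dt: "0 < dt" "dt < 1"
    and A1_smooth: "\<And>i. C_poly_infty (\<lambda>x. \<mu> x $ i)"
    and A1_one_sided: "\<exists>C>0. \<forall>x y. (\<mu> y - \<mu> x) \<bullet> (y - x) \<le> C\<^sup>2 * (1 + (norm (y - x))\<^sup>2)"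
    and A2_smooth: "\<And>i j. C_poly_infty (\<lambda>x. \<sigma> x $ i $ j)"
    and A2_lipschitz: "\<exists>C>0. \<forall>x y.
          (\<Sum>i\<in>UNIV. \<Sum>j\<in>UNIV. (\<sigma> y $ i $ j - \<sigma> x $ i $ j)\<^sup>2) \<le> C\<^sup>2 * (norm (y - x))\<^sup>2"
    and A2_invertible: "\<And>x. invertible (\<sigma> x)"
    and A3_smooth: "\<And>i. C_k 4 (p i)"
    and A3_prob: "\<And>i x v. 0 < p i (x, v) \<and> p i (x, v) < 1"
    and A3_half: "\<And>i x. p i (x, 0) = 1 / 2"
    and A3_deriv: "\<And>i x. partial_deriv (0, axis i 1) (p i) (x, 0)
          = 1 / 2 * (matrix_inv (\<sigma> x) *v \<mu> x) $ i * sqrt dt"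
    and A4: "\<exists>C>0. \<exists>m::nat. \<forall>i. partials_bounded_by 4
          (\<lambda>(x, \<xi>). p i (x, (1 / sqrt dt) *\<^sub>R \<xi>))
          (\<lambda>(x, \<xi>). C * (1 + norm x ^ m + norm \<xi> ^ m))"
    and L1: "\<And>i j x. i \<noteq> j \<Longrightarrow> \<sigma> x $ i $ j = 0"
    and L2: "\<exists>M N. M > N \<and> N > 0 \<and> (\<forall>i x. N \<le> \<sigma> x $ i $ i \<and> \<sigma> x $ i $ i \<le> M)"
    and L3_pos: "\<And>i. filterlim (\<lambda>x. \<mu> x $ i) at_top
          (inf at_infinity (principal {x. x $ i < - infnorm x / 2}))"
    and L3_neg: "\<And>i. filterlim (\<lambda>x. \<mu> x $ i) at_bot
          (inf at_infinity (principal {x. x $ i > infnorm x / 2}))"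
    and L4: "\<exists>g :: 'd \<Rightarrow> real ^ 'd \<Rightarrow> real \<Rightarrow> real. \<forall>i.
          (\<forall>x v. p i (x, v) = g i x (v $ i)) \<and>
          (\<forall>K :: ((real ^ 'd) \<times> real) set. compact K \<longrightarrow> (\<exists>c>0. \<forall>(x, s)\<in>K. c \<le> g i x s)) \<and>
          (\<forall>\<epsilon>>0. \<exists>A. \<forall>x s. (s * \<mu> x $ i > A \<longrightarrow> g i x s > 1 - \<epsilon>) \<and>
                              (s * \<mu> x $ i < - A \<longrightarrow> g i x s < \<epsilon>))"
  shows "\<exists>\<pi> :: (real ^ 'd) measure.
      invariant_prob (skew_kernel dt \<sigma> p) \<pi> \<and>
      (\<forall>k::nat. integrable \<pi> (\<lambda>x. norm x ^ k)) \<and>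
      (\<exists>C>0. \<exists>r>0. \<exists>V :: real ^ 'd \<Rightarrow> real. (\<forall>x. 1 \<le> V x) \<and>
        (\<forall>n x. tv_norm_diff (kernel_power (skew_kernel dt \<sigma> p) n x) \<pi>
               \<le> C * V x * exp (- r * real n)))"
proof -
  have \<sigma>_cont: "continuous_on UNIV (\<lambda>x. \<sigma> x $ i $ j)" for i j
    using A2_smooth[of i j] by (auto simp: C_poly_infty_def C_poly_def intro: C_k_continuous)
  have p_cont: "continuous_on UNIV (p i)" for i by (rule C_k_continuous[OF A3_smooth])
  obtain N M where NM: "0 < N" "\<And>i x. N \<le> \<sigma> x $ i $ i" "\<And>i x. \<sigma> x $ i $ i \<le> M"
    using L2 by blast
  have push: "\<exists>r. \<forall>x i v. \<forall>\<tau>\<in>{1, - 1}. r \<le> norm x \<longrightarrow> \<tau> * x $ i > infnorm x / 2 \<longrightarrow>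
      (\<tau> * v $ i > \<delta> \<longrightarrow> p i (x, v) < \<epsilon>) \<and> (\<tau> * v $ i < - \<delta> \<longrightarrow> p i (x, v) > 1 - \<epsilon>)"
    if \<epsilon>: "0 < \<epsilon>" and \<delta>: "0 < \<delta>" for \<epsilon> \<delta>
  proof -
    have "\<exists>A. \<forall>x v. (v $ i * \<mu> x $ i > A \<longrightarrow> p i (x, v) > 1 - \<epsilon>) \<and> (v $ i * \<mu> x $ i < - A \<longrightarrow> p i (x, v) < \<epsilon>)" for i
      using L4 \<epsilon> by metis
    then obtain A where A: "\<And>i x v. v $ i * \<mu> x $ i > A i \<Longrightarrow> p i (x, v) > 1 - \<epsilon>"
        "\<And>i x v. v $ i * \<mu> x $ i < - A i \<Longrightarrow> p i (x, v) < \<epsilon>"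
      by metis
    \<comment> \<open>Noise beyond \<delta> times drift beyond \<open>Z i\<close> has size above
      \<open>\<delta> * Z i = |A i| + 1\<close>, past the threshold of \<open>L4\<close>. The
      absolute value is taken since \<open>A i\<close> may be negative.\<close>
    define Z where "Z i = (\<bar>A i\<bar> + 1) / \<delta>" for i
    have Z: "0 < Z i" "A i < \<delta> * Z i" for i using \<delta> by (auto simp: Z_def)
    have "\<exists>r. \<forall>x. r \<le> norm x \<longrightarrow> x $ i < - infnorm x / 2 \<longrightarrow> Z i < \<mu> x $ i" for i
      using L3_pos[of i] unfolding filterlim_at_top_dense eventually_inf_principal eventually_at_infinity
      by auto
    then obtain r1 where r1: "\<And>i x. r1 i \<le> norm x \<Longrightarrow> x $ i < - infnorm x / 2 \<Longrightarrow> Z i < \<mu> x $ i"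
      by metis
    have "\<exists>r. \<forall>x. r \<le> norm x \<longrightarrow> x $ i > infnorm x / 2 \<longrightarrow> \<mu> x $ i < - Z i" for i
      using L3_neg[of i] unfolding filterlim_at_bot_dense eventually_inf_principal eventually_at_infinity
      by auto
    then obtain r2 where r2: "\<And>i x. r2 i \<le> norm x \<Longrightarrow> x $ i > infnorm x / 2 \<Longrightarrow> \<mu> x $ i < - Z i"
      by metis
    define r where "r = Max (range (\<lambda>i. max (r1 i) (r2 i)))"
    have r: "r1 i \<le> r" "r2 i \<le> r" for i
      using Max_ge[of "range (\<lambda>i. max (r1 i) (r2 i))" "max (r1 i) (r2 i)"] by (auto simp: r_def)
    have pushed: "(\<tau> * v $ i > \<delta> \<longrightarrow> p i (x, v) < \<epsilon>) \<and> (\<tau> * v $ i < - \<delta> \<longrightarrow> p i (x, v) > 1 - \<epsilon>)"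
      if \<tau>: "\<tau> \<in> {1, - 1}" and x: "r \<le> norm x" "\<tau> * x $ i > infnorm x / 2" for x v i \<tau>
    proof -
      \<comment> \<open>Multiplying by \<open>- \<tau>\<close> treats both sides of the origin
        alike: far out the drift points inwards with strength above \<open>Z i\<close>. Outward
        noise then makes the product with the drift very negative, inward noise very
        positive.\<close>
      have \<mu>: "Z i < - \<tau> * \<mu> x $ i"
        using \<tau> x r1[of i x] r2[of i x] r[of i] by auto
      have eq: "v $ i * \<mu> x $ i = - ((\<tau> * v $ i) * (- \<tau> * \<mu> x $ i))" using \<tau> by auto
      have big: "\<delta> * Z i < s * (- \<tau> * \<mu> x $ i)" if "\<delta> < s" for s
        using \<mu> Z(1)[of i] \<delta> that by (intro mult_strict_mono) auto
      have "p i (x, v) < \<epsilon>" if "\<tau> * v $ i > \<delta>"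
        using A(2)[of v i x] big[OF that] Z(2)[of i] unfolding eq by linarith
      moreover have "p i (x, v) > 1 - \<epsilon>" if "\<tau> * v $ i < - \<delta>"
      proof -
        have "\<delta> * Z i < (- (\<tau> * v $ i)) * (- \<tau> * \<mu> x $ i)" using that by (intro big) simp
        then have "A i < v $ i * \<mu> x $ i" unfolding eq using Z(2)[of i] by simp
        then show ?thesis by (rule A(1))
      qed
      ultimately show ?thesis by blast
    qed
    then show ?thesis by blast
  qed
  interpret diagonal_skew dt \<sigma> p N M
    by unfold_locales
      (rule dt(1) \<sigma>_cont p_cont A3_prob[THEN conjunct1] A3_prob[THEN conjunct2] L1 NM push | assumption)+
  show ?thesis by (rule geometric_ergodicity)
qed

end
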